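(* Let $a\in[0,\infty)$, $b\in(0,\infty)$, $\sigma\in(0,\infty)$, and let $m$ be a L\'evy measure on $(0,\infty)$ with $\int_0^\infty z\,m(\mathrm{d}z)<\infty$. Let $(Y_t)_{t\geq0}$ be the unique strong solution of the SDE $$\mathrm{d}Y_t = (a - bY_t)\,\mathrm{d}t + \sigma\sqrt{Y_t}\,\mathrm{d}W_t + \mathrm{d}J_t,\qquad t\in[0,\infty),$$ satisfying $\mathbb{P}(Y_0=y_0)=1$ with some $y_0\in[0,\infty)$. Then $$\frac1t\int_0^t Y_s\,\mathrm{d}s \longrightarrow \frac1b\left(a+\int_0^\infty z\,m(\mathrm{d}z)\right)\in[0,\infty)\qquad\text{in probability as } t\to\infty.$$
   Context: $(W_t)_{t\geq0}$ is a one-dimensional standard Wiener process, and $(J_t)_{t\geq0}$ is a subordinator, independent of $W$, with zero drift and L\'evy measure $m$ concentrated on $(0,\infty)$, i.e. $\mathbb{E}(\mathrm{e}^{uJ_t}) = \exp\{t\int_0^\infty(\mathrm{e}^{uz}-1)\,m(\mathrm{d}z)\}$ for all $t\geq0$ and all complex $u$ with $\mathrm{Re}(u)\leq0$. The SDE has a pathwise unique strong solution, and it is almost surely non-negative for all times. *)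

theory Defs
  imports "HOL-Probability.Probability"
begin

text \<open>
  A process is a function from time to random variables; only its values at times
  \<open>t \<ge> 0\<close> are ever used.
\<close>
type_synonym 'a process = "real \<Rightarrow> 'a \<Rightarrow> real"


section \<open>Convergence in probability\<close>

text \<open>
  Measurability is part of the definition, so that the probabilities are never those of
  non-measurable sets (which \<^const>\<open>measure\<close> would evaluate to \<open>0\<close>).
\<close>
definition tendsto_in_prob ::
    "'a measure \<Rightarrow> ('i \<Rightarrow> 'a \<Rightarrow> real) \<Rightarrow> ('a \<Rightarrow> real) \<Rightarrow> 'i filter \<Rightarrow> bool" where
  "tendsto_in_prob M X Z G \<longleftrightarrow>
     Z \<in> borel_measurable M \<and> (\<forall>\<^sub>F i in G. X i \<in> borel_measurable M) \<and>
     (\<forall>\<epsilon>>0. ((\<lambda>i. \<P>(\<omega> in M. \<epsilon> < \<bar>X i \<omega> - Z \<omega>\<bar>)) \<longlongrightarrow> 0) G)"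


section \<open>Wiener processes and subordinators\<close>

definition cadlag :: "(real \<Rightarrow> real) \<Rightarrow> bool" where
  "cadlag f \<longleftrightarrow>
     (\<forall>t\<ge>0. (f \<longlongrightarrow> f t) (at_right t)) \<and> (\<forall>t>0. \<exists>l. (f \<longlongrightarrow> l) (at_left t))"

definition independent_increments :: "'a measure \<Rightarrow> 'a process \<Rightarrow> bool" where
  "independent_increments M X \<longleftrightarrow>
     (\<forall>(n::nat) \<tau>. 0 \<le> \<tau> 0 \<and> (\<forall>i<n. \<tau> i \<le> \<tau> (Suc i)) \<longrightarrow>
        prob_space.indep_vars M (\<lambda>_. borel) (\<lambda>i \<omega>. X (\<tau> (Suc i)) \<omega> - X (\<tau> i) \<omega>) {..<n})"

definition wiener_process :: "'a measure \<Rightarrow> 'a process \<Rightarrow> bool" where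
  "wiener_process M W \<longleftrightarrow>
     (\<forall>t\<ge>0. W t \<in> borel_measurable M) \<and>
     (AE \<omega> in M. W 0 \<omega> = 0) \<and>
     independent_increments M W \<and>
     (\<forall>s t. 0 \<le> s \<and> s < t \<longrightarrow>
        distributed M lborel (\<lambda>\<omega>. W t \<omega> - W s \<omega>) (normal_density 0 (sqrt (t - s)))) \<and>
     (AE \<omega> in M. continuous_on {0..} (\<lambda>t. W t \<omega>))"

definition levy_process :: "'a measure \<Rightarrow> 'a process \<Rightarrow> bool" where
  "levy_process M X \<longleftrightarrow>
     (\<forall>t\<ge>0. X t \<in> borel_measurable M) \<and>
     (AE \<omega> in M. X 0 \<omega> = 0) \<and>
     independent_increments M X \<and>
     (\<forall>s t. 0 \<le> s \<and> s \<le> t \<longrightarrow>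
        distr M borel (\<lambda>\<omega>. X t \<omega> - X s \<omega>) = distr M borel (X (t - s))) \<and>
     (AE \<omega> in M. cadlag (\<lambda>t. X t \<omega>))"

definition levy_measure_on_pos :: "real measure \<Rightarrow> bool" where
  "levy_measure_on_pos m \<longleftrightarrow>
     sets m = sets borel \<and> emeasure m {..0} = 0 \<and> (\<integral>\<^sup>+z. ennreal (min 1 (z\<^sup>2)) \<partial>m) < \<infinity>"

text \<open>
  A subordinator is a Levy process with non-decreasing paths. That its drift is zero and
  its Levy measure is \<open>m\<close> is expressed by the Laplace transform.
\<close>
definition driftless_subordinator :: "'a measure \<Rightarrow> real measure \<Rightarrow> 'a process \<Rightarrow> bool" where
  "driftless_subordinator M m J \<longleftrightarrow>
     levy_process M J \<and>
     (AE \<omega> in M. mono_on {0..} (\<lambda>t. J t \<omega>)) \<and>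
     (\<forall>t\<ge>0. \<forall>u::complex. Re u \<le> 0 \<longrightarrow>
        (LINT \<omega>|M. exp (u * of_real (J t \<omega>)))
          = exp (of_real t * (LINT z:{0<..}|m. exp (u * of_real z) - 1)))"

text \<open>Independence as processes, i.e. as random elements of the path space.\<close>
definition independent_processes :: "'a measure \<Rightarrow> 'a process \<Rightarrow> 'a process \<Rightarrow> bool" where
  "independent_processes M X Z \<longleftrightarrow>
     prob_space.indep_var M
       (PiM {0..} (\<lambda>_. borel)) (\<lambda>\<omega>. \<lambda>t\<in>{0..}. X t \<omega>)
       (PiM {0..} (\<lambda>_. borel)) (\<lambda>\<omega>. \<lambda>t\<in>{0..}. Z t \<omega>)"


section \<open>The Ito integral\<close>

text \<open>
  The augmented filtration generated by \<open>W\<close> and \<open>J\<close>. An almost surely constant initial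
  value would contribute only events of probability zero or one, which are already included.
\<close>
definition augmented_filtration ::
    "'a measure \<Rightarrow> 'a process \<Rightarrow> 'a process \<Rightarrow> real \<Rightarrow> 'a measure" where
  "augmented_filtration M W J t =
     sigma (space M)
       ((\<Union>s\<in>{0..t}. {W s -` A \<inter> space M | A. A \<in> sets borel} \<union>
                      {J s -` A \<inter> space M | A. A \<in> sets borel}) \<union> null_sets M)"

definition progressively_measurable :: "(real \<Rightarrow> 'a measure) \<Rightarrow> 'a process \<Rightarrow> bool" where
  "progressively_measurable F H \<longleftrightarrow>
     (\<forall>T\<ge>0. (\<lambda>(s, \<omega>). H s \<omega>) \<in> borel_measurable (restrict_space borel {0..T} \<Otimes>\<^sub>M F T))"

text \<open>
  Simple integrands \<open>\<Sum>i<n. \<xi> i * indicator {\<tau> i<..\<tau> (i + 1)}\<close>, encoded by the triple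
  \<open>(n, \<tau>, \<xi>)\<close>.
\<close>
type_synonym 'a simple_integrand = "nat \<times> (nat \<Rightarrow> real) \<times> (nat \<Rightarrow> 'a \<Rightarrow> real)"

definition simple_integrand :: "(real \<Rightarrow> 'a measure) \<Rightarrow> 'a simple_integrand \<Rightarrow> bool" where
  "simple_integrand F = (\<lambda>(n, \<tau>, \<xi>).
     0 \<le> \<tau> 0 \<and> (\<forall>i<n. \<tau> i \<le> \<tau> (Suc i)) \<and>
     (\<forall>i<n. \<xi> i \<in> borel_measurable (F (\<tau> i)) \<and> (\<exists>C. \<forall>\<omega>\<in>space (F (\<tau> i)). \<bar>\<xi> i \<omega>\<bar> \<le> C)))"

definition simple_process :: "'a simple_integrand \<Rightarrow> 'a process" where
  "simple_process = (\<lambda>(n, \<tau>, \<xi>) s \<omega>. \<Sum>i<n. \<xi> i \<omega> * indicator {\<tau> i<..\<tau> (Suc i)} s)"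

definition simple_integral :: "'a process \<Rightarrow> 'a simple_integrand \<Rightarrow> 'a process" where
  "simple_integral W = (\<lambda>(n, \<tau>, \<xi>) t \<omega>.
     \<Sum>i<n. \<xi> i \<omega> * (W (min t (\<tau> (Suc i))) \<omega> - W (min t (\<tau> i)) \<omega>))"

text \<open>
  \<open>I\<close> is (a continuous version of) the Ito integral process of \<open>H\<close> with respect to \<open>W\<close>, for
  progressively measurable, almost surely locally square-integrable \<open>H\<close>: the limit in
  probability of the elementary integrals of simple integrands which approximate \<open>H\<close> in
  \<open>L\<^sup>2[0,T]\<close>, in probability, for every \<open>T\<close>.
\<close>
definition ito_integral ::
    "'a measure \<Rightarrow> (real \<Rightarrow> 'a measure) \<Rightarrow> 'a process \<Rightarrow> 'a process \<Rightarrow> 'a process \<Rightarrow> bool" where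
  "ito_integral M F W H I \<longleftrightarrow>
     progressively_measurable F H \<and>
     (\<forall>T\<ge>0. AE \<omega> in M. set_integrable lborel {0..T} (\<lambda>s. (H s \<omega>)\<^sup>2)) \<and>
     (\<forall>t\<ge>0. I t \<in> borel_measurable (F t)) \<and>
     (AE \<omega> in M. continuous_on {0..} (\<lambda>t. I t \<omega>)) \<and>
     (\<exists>S :: nat \<Rightarrow> 'a simple_integrand.
        (\<forall>k. simple_integrand F (S k)) \<and>
        (\<forall>T\<ge>0. tendsto_in_prob M
           (\<lambda>k \<omega>. LBINT s:{0..T}. (simple_process (S k) s \<omega> - H s \<omega>)\<^sup>2) (\<lambda>_. 0) sequentially) \<and>
        (\<forall>t\<ge>0. tendsto_in_prob M (\<lambda>k. simple_integral W (S k) t) (I t) sequentially))"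


section \<open>The jump-type CIR equation\<close>

text \<open>
  Strong solutions of \<open>dY\<^sub>t = (a - b Y\<^sub>t) dt + \<sigma> \<surd>Y\<^sub>t dW\<^sub>t + dJ\<^sub>t\<close>. Non-negativity belongs to the
  notion of solution because the square root is only meant for non-negative arguments,
  whereas \<^const>\<open>sqrt\<close> is total. Progressive measurability holds automatically for adapted
  processes all of whose paths are cadlag, and it implies adaptedness.
\<close>
definition strong_solution ::
    "'a measure \<Rightarrow> 'a process \<Rightarrow> 'a process \<Rightarrow> real \<Rightarrow> real \<Rightarrow> real \<Rightarrow> 'a process \<Rightarrow> bool" where
  "strong_solution M W J a b \<sigma> Y \<longleftrightarrow>
     progressively_measurable (augmented_filtration M W J) Y \<and>
     (AE \<omega> in M. cadlag (\<lambda>t. Y t \<omega>)) \<and>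
     (AE \<omega> in M. \<forall>t\<ge>0. 0 \<le> Y t \<omega>) \<and>
     (\<exists>I. ito_integral M (augmented_filtration M W J) W (\<lambda>t \<omega>. \<sigma> * sqrt (Y t \<omega>)) I \<and>
        (AE \<omega> in M. \<forall>t\<ge>0.
           Y t \<omega> = Y 0 \<omega> + (LBINT s:{0..t}. a - b * Y s \<omega>) + I t \<omega> + J t \<omega>))"

end

theory Submission
  imports Defs
begin

text \<open>
  Write \<open>A t\<close> for the integral of \<open>Y\<close> over \<open>{0..t}\<close>, \<open>I\<close> for the stochastic integral and
  \<open>\<mu>\<close> for the first moment of the Levy measure. The equation then reads
  \<open>Y t + b * A t = y0 + a * t + I t + J t\<close>, and the claim is that \<open>b * A t / t\<close> tends to \<open>a + \<mu>\<close>.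
  The jump part obeys the law of large numbers \<open>J t / t \<longlonglongrightarrow> \<mu>\<close>
  (\<open>subordinator_law_of_large_numbers\<close>), read off from the Laplace transform. It remains to see
  that \<open>I t / t\<close> tends to zero and that the term \<open>Y t\<close> does no harm.

  The quadratic variation of \<open>I\<close> is \<open>\<sigma>\<^sup>2 * A t\<close>, so a bound for \<open>A t\<close> is needed first. A
  bound in probability is enough, and Lenglart's inequality (\<open>ito_integral_lenglart\<close>)
  provides it: \<open>I t\<close> is rarely large while its quadratic variation is not. For simple
  integrands this follows from the isometry after dropping the coefficients that would make
  the quadratic variation too large, and it passes to limits in probability.
  Since \<open>Y\<close> is non-negative, \<open>b * A t \<le> y0 + a * t + I t + J t\<close>: a large
  \<open>A t\<close> needs an \<open>I t\<close> of the same order, while \<open>I t\<close> is typically of the order of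
  \<open>sqrt (A t)\<close>. Decomposing by the dyadic size of \<open>A t\<close> (\<open>peeling_bound\<close>) yields
  \<open>A t \<le> K * t\<close> with probability tending to one, hence \<open>I t / t \<longlonglongrightarrow> 0\<close>
  (\<open>noise_negligible\<close>).

  So \<open>Y + b * A = R\<close> with \<open>R t / t \<longlonglongrightarrow> a + \<mu>\<close>, and the rest is a statement about such
  relaxation equations with \<open>Y \<ge> 0\<close> (\<open>time_average_tendsto\<close>). The upper bound is
  immediate. If \<open>b * A t\<close> were too small by a multiple of \<open>t\<close>, then \<open>Y\<close> would be of order
  \<open>t\<close> at most times of a long window before \<open>t\<close>, which by Fubini's theorem
  (\<open>occupation_lower_bound\<close>) would make \<open>A t\<close> too large.
\<close>

section \<open>The augmented filtration and the independence of Wiener increments\<close>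

lemma sets_augmented_filtration:
  "sets (augmented_filtration M W J t) = sigma_sets (space M)
       ((\<Union>s\<in>{0..t}. {W s -` A \<inter> space M | A. A \<in> sets borel} \<union>
                      {J s -` A \<inter> space M | A. A \<in> sets borel}) \<union> null_sets M)"
  unfolding augmented_filtration_def
  by (rule sets_measure_of) (auto simp: null_sets_def dest: sets.sets_into_space)

lemma space_augmented_filtration [simp]: "space (augmented_filtration M W J t) = space M"
  by (simp add: augmented_filtration_def space_measure_of_conv)

lemma sets_augmented_filtration_le:
  assumes "\<And>s. 0 \<le> s \<Longrightarrow> W s \<in> borel_measurable M" "\<And>s. 0 \<le> s \<Longrightarrow> J s \<in> borel_measurable M"
  shows "sets (augmented_filtration M W J t) \<subseteq> sets M"
  unfolding sets_augmented_filtration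
  by (rule sets.sigma_sets_subset) (auto intro!: measurable_sets assms)

lemma sets_augmented_filtration_mono:
  assumes "s \<le> t"
  shows "sets (augmented_filtration M W J s) \<subseteq> sets (augmented_filtration M W J t)"
  unfolding sets_augmented_filtration using assms
  by (intro sigma_sets_mono' Un_mono UN_mono) auto

lemma measurable_augmented_filtration:
  assumes "\<And>s. 0 \<le> s \<Longrightarrow> W s \<in> borel_measurable M" "\<And>s. 0 \<le> s \<Longrightarrow> J s \<in> borel_measurable M"
    and "X \<in> borel_measurable (augmented_filtration M W J t)"
  shows "X \<in> borel_measurable M"
  by (rule subsetD[OF measurable_mono assms(3)])
     (simp_all add: sets_augmented_filtration_le assms(1,2))

lemma measurable_augmented_filtration_mono:
  assumes "X \<in> borel_measurable (augmented_filtration M W J s)" "s \<le> t"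
  shows "X \<in> borel_measurable (augmented_filtration M W J t)"
  by (rule subsetD[OF measurable_mono assms(1)])
     (simp_all add: sets_augmented_filtration_mono assms(2))

lemma measurable_augmented_filtration_W:
  assumes "0 \<le> s" "s \<le> t"
  shows "W s \<in> borel_measurable (augmented_filtration M W J t)"
proof (rule measurableI)
  fix A :: "real set" assume "A \<in> sets borel"
  then show "W s -` A \<inter> space (augmented_filtration M W J t) \<in> sets (augmented_filtration M W J t)"
    unfolding sets_augmented_filtration using assms by (intro sigma_sets.Basic) auto
qed simp

context prob_space begin

text \<open>
  Sort the finitely many past times into a grid that starts at \<open>0\<close> and ends with \<open>s\<close> and \<open>t\<close>.
  Since \<open>W 0 = 0\<close> almost surely, each past value is a partial sum of the grid increments
  that precede the last one, and the last one is \<open>W t - W s\<close>: the two sides live on disjoint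
  blocks of a finite independent family.
\<close>
lemma indep_of_past_cylinder:
  assumes W: "wiener_process M W" and st: "0 \<le> s" "s \<le> t"
    and U: "finite U" "U \<subseteq> {0..s}"
    and A: "\<And>u. u \<in> U \<Longrightarrow> A u \<in> sets borel" and B: "B \<in> sets borel"
  shows "prob {\<omega>\<in>space M. (\<forall>u\<in>U. W u \<omega> \<in> A u) \<and> W t \<omega> - W s \<omega> \<in> B}
       = prob {\<omega>\<in>space M. \<forall>u\<in>U. W u \<omega> \<in> A u} * prob {\<omega>\<in>space M. W t \<omega> - W s \<omega> \<in> B}"
proof -
  define n where "n = card U"
  define xs where "xs = sorted_list_of_set U"
  have xs: "sorted xs" "set xs = U" "length xs = n"
    using U by (auto simp: xs_def n_def)
  define \<tau> where "\<tau> i = (if i = 0 then 0 else if i \<le> n then xs ! (i - 1) else if i = Suc n then s else t)"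
    for i
  have xs_in: "xs ! i \<in> {0..s}" if "i < n" for i
    using that xs U by (metis nth_mem subsetD)
  have mono: "\<tau> i \<le> \<tau> (Suc i)" if "i < n + 2" for i
  proof -
    have "i = 0 \<or> 0 < i \<and> i < n \<or> i = n \<and> 0 < n \<or> i = Suc n" using that by auto
    then consider "i = 0" | "0 < i" "i < n" | "i = n" "0 < n" | "i = Suc n" by blast
    then show ?thesis
    proof cases
      case 2
      then show ?thesis using sorted_nth_mono[OF xs(1), of "i-1" i] xs(3) by (simp add: \<tau>_def)
    qed (use xs_in[of 0] xs_in[of "n-1"] st in \<open>auto simp: \<tau>_def\<close>)
  qed
  define D where "D i \<omega> = W (\<tau> (Suc i)) \<omega> - W (\<tau> i) \<omega>" for i \<omega>
  have \<tau>0: "0 \<le> \<tau> i" for i using xs_in[of "i-1"] st by (auto simp: \<tau>_def)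
  have Wm [measurable]: "W (\<tau> i) \<in> borel_measurable M" for i
    using W \<tau>0 by (auto simp: wiener_process_def)
  have Wm' [measurable]: "W u \<in> borel_measurable M" if "u \<ge> 0" for u
    using W that by (auto simp: wiener_process_def)
  have Um [measurable]: "{\<omega>\<in>space M. \<forall>u\<in>U. W u \<omega> \<in> A u} \<in> events"
    using U A by (intro sets.sets_Collect_finite_All predE[OF pred_sets2[OF _ Wm']]) auto
  have indep: "indep_vars (\<lambda>_. borel) D {..<n+2}"
    using W mono \<tau>0[of 0] unfolding wiener_process_def independent_increments_def D_def by blast
  have iv: "indep_var (PiM {..n} (\<lambda>_. borel)) (\<lambda>\<omega>. restrict (\<lambda>i. D i \<omega>) {..n})
                  (PiM {Suc n} (\<lambda>_. borel)) (\<lambda>\<omega>. restrict (\<lambda>i. D i \<omega>) {Suc n})"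
    by (rule indep_var_restrict[OF indep]) auto
  define C where "C = {x \<in> space (PiM {..n} (\<lambda>_. borel)). \<forall>i\<in>{..<n}. (\<Sum>j<Suc i. x j) \<in> A (xs ! i)}"
  have C: "C \<in> sets (PiM {..n} (\<lambda>_. borel :: real measure))"
    unfolding C_def
  proof (intro sets.sets_Collect_finite_All predE[OF pred_sets2[of _ borel]])
    fix i assume "i \<in> {..<n}"
    then have i: "i < n" by simp
    show "A (xs ! i) \<in> sets borel" using A i xs by (metis nth_mem)
    show "(\<lambda>x. \<Sum>j<Suc i. x j) \<in> borel_measurable (PiM {..n} (\<lambda>_. borel :: real measure))"
      using i by (intro borel_measurable_sum measurable_component_singleton) auto
  qed auto
  define E where "E = {x \<in> space (PiM {Suc n} (\<lambda>_. borel :: real measure)). x (Suc n) \<in> B}"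
  have E: "E \<in> sets (PiM {Suc n} (\<lambda>_. borel :: real measure))"
    unfolding E_def by (intro predE[OF pred_sets2[OF B]] measurable_component_singleton) auto
  have DE: "D (Suc n) \<omega> = W t \<omega> - W s \<omega>" for \<omega> by (simp add: D_def \<tau>_def)
  have inE: "restrict (\<lambda>i. D i \<omega>) {Suc n} \<in> E \<longleftrightarrow> W t \<omega> - W s \<omega> \<in> B" for \<omega>
    by (simp add: E_def space_PiM DE)
  have W0: "AE \<omega> in M. W 0 \<omega> = 0" using W by (auto simp: wiener_process_def)
  have eqC: "AE \<omega> in M. restrict (\<lambda>i. D i \<omega>) {..n} \<in> C \<longleftrightarrow> (\<forall>u\<in>U. W u \<omega> \<in> A u)"
    using W0
  proof eventually_elim
    case (elim \<omega>)
    have "(\<Sum>j<Suc i. restrict (\<lambda>i. D i \<omega>) {..n} j) = W (xs ! i) \<omega>" if "i < n" for i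
    proof -
      have "(\<Sum>j<Suc i. restrict (\<lambda>i. D i \<omega>) {..n} j) = (\<Sum>j<Suc i. D j \<omega>)"
        using that by (intro sum.cong) auto
      also have "\<dots> = W (\<tau> (Suc i)) \<omega> - W (\<tau> 0) \<omega>"
        unfolding D_def by (rule sum_lessThan_telescope)
      also have "\<dots> = W (xs ! i) \<omega>" using that elim by (simp add: \<tau>_def)
      finally show ?thesis .
    qed
    then have "restrict (\<lambda>i. D i \<omega>) {..n} \<in> C \<longleftrightarrow> (\<forall>i<n. W (xs ! i) \<omega> \<in> A (xs ! i))"
      by (auto simp: C_def space_PiM)
    also have "\<dots> \<longleftrightarrow> (\<forall>u\<in>U. W u \<omega> \<in> A u)"
      using xs by (metis in_set_conv_nth)
    finally show ?case .
  qed
  have Dm [measurable]: "D i \<in> borel_measurable M" for i unfolding D_def by measurable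
  have RC: "(\<lambda>\<omega>. restrict (\<lambda>i. D i \<omega>) {..n}) \<in> M \<rightarrow>\<^sub>M PiM {..n} (\<lambda>_. borel)" by measurable
  have Cev: "{\<omega>\<in>space M. restrict (\<lambda>i. D i \<omega>) {..n} \<in> C} \<in> events"
    using measurable_sets[OF RC C] by (simp add: vimage_def Int_def conj_commute)
  have Bev: "{\<omega>\<in>space M. W t \<omega> - W s \<omega> \<in> B} \<in> events"
    using st by (intro predE[OF pred_sets2[OF B]] borel_measurable_diff Wm') auto
  have "prob {\<omega>\<in>space M. (\<forall>u\<in>U. W u \<omega> \<in> A u) \<and> W t \<omega> - W s \<omega> \<in> B}
      = prob {\<omega>\<in>space M. restrict (\<lambda>i. D i \<omega>) {..n} \<in> C \<and> W t \<omega> - W s \<omega> \<in> B}"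
  proof (rule finite_measure_eq_AE)
    show "AE x in M. (x \<in> {\<omega>\<in>space M. (\<forall>u\<in>U. W u \<omega> \<in> A u) \<and> W t \<omega> - W s \<omega> \<in> B}) \<longleftrightarrow>
      (x \<in> {\<omega>\<in>space M. restrict (\<lambda>i. D i \<omega>) {..n} \<in> C \<and> W t \<omega> - W s \<omega> \<in> B})"
      using eqC by eventually_elim auto
  qed (rule sets.sets_Collect_conj[OF Bev Um] sets.sets_Collect_conj[OF Bev Cev])+
  also have "\<dots> = prob ((\<lambda>\<omega>. (restrict (\<lambda>i. D i \<omega>) {..n}, restrict (\<lambda>i. D i \<omega>) {Suc n})) -` (C \<times> E) \<inter> space M)"
    by (rule arg_cong[of _ _ prob], rule set_eqI,
        simp only: mem_Collect_eq Int_iff vimage_eq mem_Sigma_iff inE, blast)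
  also have "\<dots> = prob ((\<lambda>\<omega>. restrict (\<lambda>i. D i \<omega>) {..n}) -` C \<inter> space M) *
       prob ((\<lambda>\<omega>. restrict (\<lambda>i. D i \<omega>) {Suc n}) -` E \<inter> space M)"
    by (rule indep_varD[OF iv C E])
  also have "prob ((\<lambda>\<omega>. restrict (\<lambda>i. D i \<omega>) {Suc n}) -` E \<inter> space M)
       = prob {\<omega>\<in>space M. W t \<omega> - W s \<omega> \<in> B}"
    by (rule arg_cong[of _ _ prob], rule set_eqI,
        simp only: mem_Collect_eq Int_iff vimage_eq mem_Sigma_iff inE, blast)
  also have "prob ((\<lambda>\<omega>. restrict (\<lambda>i. D i \<omega>) {..n}) -` C \<inter> space M) = prob {\<omega>\<in>space M. \<forall>u\<in>U. W u \<omega> \<in> A u}"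
  proof (rule finite_measure_eq_AE)
    show "AE x in M. (x \<in> (\<lambda>\<omega>. restrict (\<lambda>i. D i \<omega>) {..n}) -` C \<inter> space M) \<longleftrightarrow>
      (x \<in> {\<omega>\<in>space M. \<forall>u\<in>U. W u \<omega> \<in> A u})"
      using eqC by eventually_elim auto
  qed (use measurable_sets[OF RC C] Um in auto)
  finally show ?thesis .
qed

end

context prob_space begin

text \<open>
  Both sides are generated by \<open>\<inter>\<close>-stable families, so the product rule only has to be
  checked on generators. The past is generated by finite cylinders in \<open>W\<close> and \<open>J\<close>
  together with the null sets. On a cylinder the \<open>J\<close>-part splits off because it is
  independent of the whole path of \<open>W\<close>, and what remains concerns \<open>W\<close> alone.
\<close>
lemma indep_set_past_increment:
  assumes W: "wiener_process M W" and Jm: "\<And>u. 0 \<le> u \<Longrightarrow> J u \<in> borel_measurable M"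
    and WJ: "independent_processes M W J" and st: "0 \<le> s" "s \<le> t"
  shows "indep_set (sets (augmented_filtration M W J s))
           (sigma_sets (space M) {(\<lambda>\<omega>. W t \<omega> - W s \<omega>) -` B \<inter> space M | B. B \<in> sets borel})"
proof -
  have Wm: "W u \<in> borel_measurable M" if "0 \<le> u" for u
    using W that by (simp add: wiener_process_def)
  have Dm: "(\<lambda>\<omega>. W t \<omega> - W s \<omega>) \<in> borel_measurable M"
    using st by (intro borel_measurable_diff Wm) auto
  define cyl where "cyl X A U = {\<omega>\<in>space M. \<forall>u\<in>U. X u \<omega> \<in> A u}"
    for X :: "real \<Rightarrow> 'a \<Rightarrow> real" and A :: "real \<Rightarrow> real set" and U :: "real set"
  have cylm: "cyl X A U \<in> events"
    if "finite U" "\<And>u. A u \<in> sets borel" "U \<subseteq> {0..s}" "\<And>u. 0 \<le> u \<Longrightarrow> X u \<in> borel_measurable M" for X A U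
    unfolding cyl_def using that
    by (intro sets.sets_Collect_finite_All predE[OF pred_sets2[of _ borel]]) auto
  define P where "P = {cyl W A U \<inter> cyl J C U | A C U. finite U \<and> U \<subseteq> {0..s} \<and>
      (\<forall>u. A u \<in> sets borel) \<and> (\<forall>u. C u \<in> sets borel)} \<union> null_sets M"
  define Q where "Q = {(\<lambda>\<omega>. W t \<omega> - W s \<omega>) -` B \<inter> space M | B. B \<in> sets (borel :: real measure)}"
  have Pev: "P \<subseteq> events"
    unfolding P_def using cylm[OF _ _ _ Wm] cylm[OF _ _ _ Jm] by (auto intro!: sets.Int)
  have Qev: "Q \<subseteq> events"
    unfolding Q_def using measurable_sets[OF Dm] by blast
  have cyl_in_P: "cyl W A U \<inter> cyl J C U \<in> P"
    if "finite U" "U \<subseteq> {0..s}" "\<And>u. A u \<in> sets borel" "\<And>u. C u \<in> sets borel" for A C U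
    unfolding P_def by (rule UnI1, rule CollectI, intro exI conjI allI, rule refl) (rule that)+
  have ind: "indep_set P Q"
  proof (rule indep_setI[OF Pev Qev])
    fix p q assume "p \<in> P" "q \<in> Q"
    obtain B where B: "B \<in> sets borel" and q: "q = (\<lambda>\<omega>. W t \<omega> - W s \<omega>) -` B \<inter> space M"
      using \<open>q \<in> Q\<close> unfolding Q_def by blast
    have qev: "q \<in> events" using \<open>q \<in> Q\<close> Qev by blast
    from \<open>p \<in> P\<close> consider "p \<in> null_sets M" | A C U where "p = cyl W A U \<inter> cyl J C U" "finite U" "U \<subseteq> {0..s}"
       "\<And>u. A u \<in> sets borel" "\<And>u. C u \<in> sets borel" unfolding P_def by blast
    then show "prob (p \<inter> q) = prob p * prob q"
    proof cases
      case 1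
      then have "p \<inter> q \<in> null_sets M" using qev by (rule null_set_Int2)
      with 1 show ?thesis by (simp add: measure_eq_0_null_sets)
    next
      case 2
      define SW where "SW = {x \<in> space (PiM {0..} (\<lambda>_. borel :: real measure)). \<forall>u\<in>U. x u \<in> A u}"
      define SB where "SB = {x \<in> space (PiM {0..} (\<lambda>_. borel :: real measure)). x t - x s \<in> B}"
      define SJ where "SJ = {x \<in> space (PiM {0..} (\<lambda>_. borel :: real measure)). \<forall>u\<in>U. x u \<in> C u}"
      have U0: "\<And>u. u \<in> U \<Longrightarrow> u \<in> {0..}" using 2(3) by auto
      have SW: "SW \<in> sets (PiM {0..} (\<lambda>_. borel))" unfolding SW_def using 2 U0
        by (intro sets.sets_Collect_finite_All predE[OF pred_sets2[of _ borel]] measurable_component_singleton) auto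
      have SJ: "SJ \<in> sets (PiM {0..} (\<lambda>_. borel))" unfolding SJ_def using 2 U0
        by (intro sets.sets_Collect_finite_All predE[OF pred_sets2[of _ borel]] measurable_component_singleton) auto
      have SB: "SB \<in> sets (PiM {0..} (\<lambda>_. borel))" unfolding SB_def using st
        by (intro predE[OF pred_sets2[OF B]] borel_measurable_diff measurable_component_singleton) auto
      have pre: "(\<lambda>\<omega>. \<lambda>t\<in>{0..}. W t \<omega>) -` SW \<inter> space M = cyl W A U"
                "(\<lambda>\<omega>. \<lambda>t\<in>{0..}. J t \<omega>) -` SJ \<inter> space M = cyl J C U"
                "(\<lambda>\<omega>. \<lambda>t\<in>{0..}. W t \<omega>) -` SB \<inter> space M = q"
        using U0 st by (auto simp: SW_def SJ_def SB_def cyl_def q space_PiM)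
      have joint: "prob (((\<lambda>\<omega>. \<lambda>t\<in>{0..}. W t \<omega>) -` S \<inter> space M) \<inter> cyl J C U)
          = prob ((\<lambda>\<omega>. \<lambda>t\<in>{0..}. W t \<omega>) -` S \<inter> space M) * prob (cyl J C U)"
        if "S \<in> sets (PiM {0..} (\<lambda>_. borel))" for S
      proof -
        have "((\<lambda>\<omega>. \<lambda>t\<in>{0..}. W t \<omega>) -` S \<inter> space M) \<inter> cyl J C U
          = (\<lambda>\<omega>. (\<lambda>t\<in>{0..}. W t \<omega>, \<lambda>t\<in>{0..}. J t \<omega>)) -` (S \<times> SJ) \<inter> space M"
          unfolding pre(2)[symmetric] by blast
        then show ?thesis
          using indep_varD[OF WJ[unfolded independent_processes_def] that SJ] by (simp add: pre(2))
      qed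
      have J1: "prob (cyl W A U \<inter> cyl J C U) = prob (cyl W A U) * prob (cyl J C U)"
        using joint[OF SW] unfolding pre .
      have "(\<lambda>\<omega>. \<lambda>t\<in>{0..}. W t \<omega>) -` (SW \<inter> SB) \<inter> space M = cyl W A U \<inter> q"
        unfolding pre[symmetric] by blast
      then have J2: "prob (cyl W A U \<inter> q \<inter> cyl J C U) = prob (cyl W A U \<inter> q) * prob (cyl J C U)"
        using joint[OF sets.Int[OF SW SB]] by simp
      have "cyl W A U \<inter> q = {\<omega>\<in>space M. (\<forall>u\<in>U. W u \<omega> \<in> A u) \<and> W t \<omega> - W s \<omega> \<in> B}"
        "q = {\<omega>\<in>space M. W t \<omega> - W s \<omega> \<in> B}" unfolding cyl_def q by blast+
      then have J3: "prob (cyl W A U \<inter> q) = prob (cyl W A U) * prob q"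
        using indep_of_past_cylinder[OF W st 2(2,3) 2(4) B] by (simp add: cyl_def)
      have "p \<inter> q = cyl W A U \<inter> q \<inter> cyl J C U" using 2(1) by blast
      then show ?thesis by (simp add: J1 J2 J3 2(1))
    qed
  qed
  have Pst: "Int_stable P"
  proof (rule Int_stableI)
    fix a b assume ab: "a \<in> P" "b \<in> P"
    show "a \<inter> b \<in> P"
    proof (cases "a \<in> null_sets M \<or> b \<in> null_sets M")
      case True
      then have "a \<inter> b \<in> null_sets M"
        using ab Pev null_set_Int1[of b M a] null_set_Int2[of a M b] by blast
      then show ?thesis by (simp add: P_def)
    next
      case False
      then obtain A C U where a: "a = cyl W A U \<inter> cyl J C U" "finite U" "U \<subseteq> {0..s}"
         "\<And>u. A u \<in> sets borel" "\<And>u. C u \<in> sets borel" using ab(1) unfolding P_def by blast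
      from False obtain A' C' U' where b: "b = cyl W A' U' \<inter> cyl J C' U'" "finite U'" "U' \<subseteq> {0..s}"
         "\<And>u. A' u \<in> sets borel" "\<And>u. C' u \<in> sets borel" using ab(2) unfolding P_def by blast
      define mix :: "(real \<Rightarrow> real set) \<Rightarrow> (real \<Rightarrow> real set) \<Rightarrow> real \<Rightarrow> real set" where
        "mix A A' u = (if u \<in> U then A u else UNIV) \<inter> (if u \<in> U' then A' u else UNIV)" for A A' u
      have m: "cyl X (mix A A') (U \<union> U') = cyl X A U \<inter> cyl X A' U'" for X A A'
        by (auto simp: cyl_def mix_def)
      have "a \<inter> b = cyl W (mix A A') (U \<union> U') \<inter> cyl J (mix C C') (U \<union> U')"
        unfolding m a b by blast
      moreover have "mix A A' u \<in> sets borel" "mix C C' u \<in> sets borel" for u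
        using a b by (auto simp: mix_def)
      ultimately show ?thesis using cyl_in_P[of "U \<union> U'"] a(2,3) b(2,3) by simp
    qed
  qed
  have Qst: "Int_stable Q"
  proof (rule Int_stableI)
    fix a b assume "a \<in> Q" "b \<in> Q"
    then obtain A B where AB: "A \<in> sets borel" "B \<in> sets borel" "a = (\<lambda>\<omega>. W t \<omega> - W s \<omega>) -` A \<inter> space M"
       "b = (\<lambda>\<omega>. W t \<omega> - W s \<omega>) -` B \<inter> space M" unfolding Q_def by blast
    then have "a \<inter> b = (\<lambda>\<omega>. W t \<omega> - W s \<omega>) -` (A \<inter> B) \<inter> space M" by blast
    then show "a \<inter> b \<in> Q" unfolding Q_def using sets.Int[OF AB(1,2)] by blast
  qed
  have gen: "sets (augmented_filtration M W J s) \<subseteq> sigma_sets (space M) P"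
    unfolding sets_augmented_filtration
  proof (rule sigma_sets_mono')
    have 1: "W u -` A \<inter> space M \<in> P" if "u \<in> {0..s}" "A \<in> sets borel" for u A
    proof -
      have "W u -` A \<inter> space M = cyl W (\<lambda>_. A) {u} \<inter> cyl J (\<lambda>_. UNIV) {u}"
        by (auto simp: cyl_def)
      then show ?thesis using cyl_in_P[of "{u}"] that by simp
    qed
    have 2: "J u -` A \<inter> space M \<in> P" if "u \<in> {0..s}" "A \<in> sets borel" for u A
    proof -
      have "J u -` A \<inter> space M = cyl W (\<lambda>_. UNIV) {u} \<inter> cyl J (\<lambda>_. A) {u}"
        by (auto simp: cyl_def)
      then show ?thesis using cyl_in_P[of "{u}"] that by simp
    qed
    have 3: "null_sets M \<subseteq> P" by (simp add: P_def)
    show "(\<Union>s\<in>{0..s}. {W s -` A \<inter> space M | A. A \<in> sets borel} \<union>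
           {J s -` A \<inter> space M | A. A \<in> sets borel}) \<union> null_sets M \<subseteq> P"
      using 1 2 3 by blast
  qed
  have "indep_set (sigma_sets (space M) P) (sigma_sets (space M) Q)"
    by (rule indep_set_sigma_sets[OF ind Pst Qst])
  then show ?thesis
    using gen unfolding indep_sets2_eq Q_def by blast
qed

lemma indep_var_past_increment:
  assumes W: "wiener_process M W" and Jm: "\<And>u. 0 \<le> u \<Longrightarrow> J u \<in> borel_measurable M"
    and WJ: "independent_processes M W J" and st: "0 \<le> s" "s \<le> t"
    and X: "X \<in> borel_measurable (augmented_filtration M W J s)"
  shows "indep_var borel X borel (\<lambda>\<omega>. W t \<omega> - W s \<omega>)"
proof -
  have Wm: "W u \<in> borel_measurable M" if "0 \<le> u" for u
    using W that by (simp add: wiener_process_def)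
  have Dm: "(\<lambda>\<omega>. W t \<omega> - W s \<omega>) \<in> borel_measurable M"
    using st by (intro borel_measurable_diff Wm) auto
  have Xm: "X \<in> borel_measurable M"
    by (rule measurable_augmented_filtration[OF Wm Jm X])
  have "sigma_sets (space (augmented_filtration M W J s)) {X -` A \<inter> space M | A. A \<in> sets borel}
      \<subseteq> sets (augmented_filtration M W J s)"
    using measurable_sets[OF X] by (intro sets.sigma_sets_subset) auto
  with indep_set_past_increment[OF W Jm WJ st] Xm Dm show ?thesis
    unfolding indep_var_eq indep_sets2_eq by auto
qed

end


section \<open>Isometry and Lenglart's inequality on a grid\<close>

lemma mono_upto:
  fixes f :: "nat \<Rightarrow> 'b::preorder"
  assumes "\<And>i. i < n \<Longrightarrow> f i \<le> f (Suc i)" "i \<le> j" "j \<le> n"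
  shows "f i \<le> f j"
  using assms(2,3)
proof (induction j rule: dec_induct)
  case (step k)
  then show ?case using assms(1)[of k] order_trans[of "f i" "f k"] by simp
qed simp

context prob_space begin

lemma wiener_increment_moments:
  assumes W: "wiener_process M W" and st: "0 \<le> s" "s \<le> t"
  shows "integrable M (\<lambda>\<omega>. W t \<omega> - W s \<omega>)" (is ?A)
    and "integrable M (\<lambda>\<omega>. (W t \<omega> - W s \<omega>)\<^sup>2)" (is ?B)
    and "expectation (\<lambda>\<omega>. W t \<omega> - W s \<omega>) = 0" (is ?C)
    and "expectation (\<lambda>\<omega>. (W t \<omega> - W s \<omega>)\<^sup>2) = t - s" (is ?D)
proof -
  have "?A \<and> ?B \<and> ?C \<and> ?D"
  proof (cases "s = t")
    case False
    then have lt: "s < t" using st by simp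
    have D: "distributed M lborel (\<lambda>\<omega>. W t \<omega> - W s \<omega>) (normal_density 0 (sqrt (t - s)))"
      using W lt st unfolding wiener_process_def by blast
    have A: ?A
      by (rule distributed_integrable_var[OF D]) (use integrable_normal_moment[of "sqrt (t - s)" 0 1] lt in auto)
    have B: ?B
      using distributed_integrable[OF D, of "\<lambda>x. x\<^sup>2"] integrable_normal_moment[of "sqrt (t - s)" 0 2] lt by simp
    have C: ?C by (rule normal_distributed_expectation[OF _ D]) (use lt in simp)
    have ?D using normal_distributed_variance[OF _ D] lt by (simp add: C)
    with A B C show ?thesis by blast
  qed simp
  then show ?A ?B ?C ?D by blast+
qed

text \<open>
  Ito's isometry on a grid. In the square of the sum up to \<open>n\<close>, the new increment is
  independent of everything that multiplies it: the mixed term vanishes because the increment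
  is centred, and the new square contributes its variance, the length of the grid step.
\<close>
lemma wiener_grid_isometry:
  fixes \<sigma> :: "nat \<Rightarrow> real" and \<xi> :: "nat \<Rightarrow> 'a \<Rightarrow> real"
  assumes W: "wiener_process M W" and Jm: "\<And>u. 0 \<le> u \<Longrightarrow> J u \<in> borel_measurable M"
    and WJ: "independent_processes M W J"
    and \<sigma>0: "0 \<le> \<sigma> 0" and \<sigma>: "\<And>i. i < n \<Longrightarrow> \<sigma> i \<le> \<sigma> (Suc i)"
    and \<xi>: "\<And>i. i < n \<Longrightarrow> \<xi> i \<in> borel_measurable (augmented_filtration M W J (\<sigma> i))"
    and bound: "\<And>i. i < n \<Longrightarrow> \<exists>C. \<forall>\<omega>\<in>space M. \<bar>\<xi> i \<omega>\<bar> \<le> C"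
  shows "integrable M (\<lambda>\<omega>. (\<Sum>i<n. \<xi> i \<omega> * (W (\<sigma> (Suc i)) \<omega> - W (\<sigma> i) \<omega>))\<^sup>2) \<and>
     expectation (\<lambda>\<omega>. (\<Sum>i<n. \<xi> i \<omega> * (W (\<sigma> (Suc i)) \<omega> - W (\<sigma> i) \<omega>))\<^sup>2)
       = expectation (\<lambda>\<omega>. \<Sum>i<n. (\<xi> i \<omega>)\<^sup>2 * (\<sigma> (Suc i) - \<sigma> i))"
  using \<sigma> \<xi> bound
proof (induction n)
  case 0
  then show ?case by simp
next
  case (Suc n)
  have Wm: "W u \<in> borel_measurable M" if "0 \<le> u" for u
    using W that by (simp add: wiener_process_def)
  let ?F = "augmented_filtration M W J"
  define N where "N \<omega> = (\<Sum>i<n. \<xi> i \<omega> * (W (\<sigma> (Suc i)) \<omega> - W (\<sigma> i) \<omega>))" for \<omega>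
  define V where "V \<omega> = (\<Sum>i<n. (\<xi> i \<omega>)\<^sup>2 * (\<sigma> (Suc i) - \<sigma> i))" for \<omega>
  define D where "D \<omega> = W (\<sigma> (Suc n)) \<omega> - W (\<sigma> n) \<omega>" for \<omega>
  have mono: "i \<le> j \<Longrightarrow> j \<le> Suc n \<Longrightarrow> \<sigma> i \<le> \<sigma> j" for i j
    by (rule mono_upto[of "Suc n" \<sigma>]) (use Suc.prems(1) in auto)
  have pos: "0 \<le> \<sigma> i" if "i \<le> Suc n" for i using mono[of 0 i] \<sigma>0 that by simp
  have IH: "integrable M (\<lambda>\<omega>. (N \<omega>)\<^sup>2)" "expectation (\<lambda>\<omega>. (N \<omega>)\<^sup>2) = expectation V"
    using Suc unfolding N_def V_def by simp_all
  have \<xi>F: "\<xi> i \<in> borel_measurable (?F (\<sigma> n))" if "i \<le> n" for i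
    using Suc.prems(2)[of i] mono[of i n] that by (auto intro: measurable_augmented_filtration_mono)
  have NF: "N \<in> borel_measurable (?F (\<sigma> n))"
    unfolding N_def using mono pos
    by (intro borel_measurable_sum borel_measurable_times borel_measurable_diff \<xi>F
        measurable_augmented_filtration_W) auto
  have toM: "X \<in> borel_measurable M" if "X \<in> borel_measurable (?F (\<sigma> n))" for X
    by (rule measurable_augmented_filtration[OF Wm Jm that])
  have \<xi>M: "\<xi> i \<in> borel_measurable M" if "i \<le> n" for i using toM \<xi>F that by blast
  obtain C where C: "\<And>\<omega>. \<omega> \<in> space M \<Longrightarrow> \<bar>\<xi> n \<omega>\<bar> \<le> C" using Suc.prems(3)[of n] by auto
  have Nint: "integrable M N"
    by (rule square_integrable_imp_integrable[OF toM[OF NF] IH(1)])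
  have D: "integrable M D" "integrable M (\<lambda>\<omega>. (D \<omega>)\<^sup>2)" "expectation D = 0"
      "expectation (\<lambda>\<omega>. (D \<omega>)\<^sup>2) = \<sigma> (Suc n) - \<sigma> n"
    using wiener_increment_moments[OF W pos[of n], of "\<sigma> (Suc n)"] mono[of n "Suc n"]
    unfolding D_def by simp_all
  have iv: "indep_var borel X borel D" if "X \<in> borel_measurable (?F (\<sigma> n))" for X
    unfolding D_def using indep_var_past_increment[OF W Jm WJ pos _ that] mono[of n "Suc n"] by simp
  have N\<xi>: "integrable M (\<lambda>\<omega>. N \<omega> * \<xi> n \<omega>)"
  proof (rule Bochner_Integration.integrable_bound)
    show "integrable M (\<lambda>\<omega>. C * N \<omega>)" using Nint by simp
    show "(\<lambda>\<omega>. N \<omega> * \<xi> n \<omega>) \<in> borel_measurable M" using toM[OF NF] \<xi>M by simp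
    show "AE \<omega> in M. norm (N \<omega> * \<xi> n \<omega>) \<le> norm (C * N \<omega>)"
    proof (rule AE_I2)
      fix \<omega> assume "\<omega> \<in> space M"
      from C[OF this] have "\<bar>\<xi> n \<omega>\<bar> \<le> \<bar>C\<bar>" by simp
      then show "norm (N \<omega> * \<xi> n \<omega>) \<le> norm (C * N \<omega>)"
        using mult_right_mono[of "\<bar>\<xi> n \<omega>\<bar>" "\<bar>C\<bar>" "\<bar>N \<omega>\<bar>"] by (simp add: abs_mult mult.commute)
    qed
  qed
  have bsq: "integrable M (\<lambda>\<omega>. (\<xi> i \<omega>)\<^sup>2)" if i: "i \<le> n" for i
  proof -
    obtain c where c: "\<And>\<omega>. \<omega> \<in> space M \<Longrightarrow> \<bar>\<xi> i \<omega>\<bar> \<le> c" using Suc.prems(3)[of i] i by auto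
    show ?thesis
    proof (rule integrable_const_bound[of _ "c\<^sup>2"])
      show "AE \<omega> in M. norm ((\<xi> i \<omega>)\<^sup>2) \<le> c\<^sup>2"
      proof (rule AE_I2)
        fix \<omega> assume "\<omega> \<in> space M"
        from power_mono[OF c[OF this], of 2] show "norm ((\<xi> i \<omega>)\<^sup>2) \<le> c\<^sup>2" by simp
      qed
    qed (use \<xi>M[OF i] in simp)
  qed
  have iv1: "indep_var borel (\<lambda>\<omega>. N \<omega> * \<xi> n \<omega>) borel D"
    by (rule iv) (use NF \<xi>F in simp)
  have iv2: "indep_var borel (\<lambda>\<omega>. (\<xi> n \<omega>)\<^sup>2) borel (\<lambda>\<omega>. (D \<omega>)\<^sup>2)"
    using indep_var_compose[OF iv[OF \<xi>F[of n]], of "\<lambda>x. x\<^sup>2" borel "\<lambda>x. x\<^sup>2" borel] by (simp add: comp_def)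
  have c1: "integrable M (\<lambda>\<omega>. N \<omega> * \<xi> n \<omega> * D \<omega>)" "expectation (\<lambda>\<omega>. N \<omega> * \<xi> n \<omega> * D \<omega>) = 0"
    using indep_var_integrable[OF iv1 N\<xi> D(1)] indep_var_lebesgue_integral[OF iv1 N\<xi> D(1)] D(3) by simp_all
  have c2: "integrable M (\<lambda>\<omega>. (\<xi> n \<omega>)\<^sup>2 * (D \<omega>)\<^sup>2)"
     "expectation (\<lambda>\<omega>. (\<xi> n \<omega>)\<^sup>2 * (D \<omega>)\<^sup>2) = expectation (\<lambda>\<omega>. (\<xi> n \<omega>)\<^sup>2) * (\<sigma> (Suc n) - \<sigma> n)"
    using indep_var_integrable[OF iv2 bsq[of n] D(2)] indep_var_lebesgue_integral[OF iv2 bsq[of n] D(2)] D(4)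
    by simp_all
  have Vint: "integrable M V" unfolding V_def
    by (intro Bochner_Integration.integrable_sum integrable_mult_left) (simp add: bsq)
  have eq: "(\<Sum>i<Suc n. \<xi> i \<omega> * (W (\<sigma> (Suc i)) \<omega> - W (\<sigma> i) \<omega>))\<^sup>2
    = (N \<omega>)\<^sup>2 + 2 * (N \<omega> * \<xi> n \<omega> * D \<omega>) + (\<xi> n \<omega>)\<^sup>2 * (D \<omega>)\<^sup>2" for \<omega>
    by (simp add: N_def D_def power2_sum power_mult_distrib)
  have eqV: "(\<Sum>i<Suc n. (\<xi> i \<omega>)\<^sup>2 * (\<sigma> (Suc i) - \<sigma> i)) = V \<omega> + (\<xi> n \<omega>)\<^sup>2 * (\<sigma> (Suc n) - \<sigma> n)" for \<omega>
    by (simp add: V_def)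
  show ?case
    unfolding eq eqV using IH c1 c2 Vint bsq[of n] by simp
qed

text \<open>
  Lenglart's inequality for a grid: the sum can only be large without its quadratic variation
  \<open>V\<close> being large with a probability that Chebyshev's inequality controls. Instead of
  stopping when \<open>V\<close> exceeds \<open>\<eta>\<close>, drop every coefficient \<open>\<xi> i\<close> for which \<open>V (Suc i)\<close> exceeds
  \<open>\<eta>\<close>. As \<open>V (Suc i)\<close> is already known at time \<open>\<sigma> i\<close>, the thinned coefficients \<open>\<zeta>\<close> are still
  admissible in the isometry. Their quadratic variation never exceeds \<open>\<eta>\<close>, and on
  \<open>V n \<le> \<eta>\<close> nothing has been dropped.
\<close>
lemma wiener_grid_lenglart:
  fixes \<sigma> :: "nat \<Rightarrow> real" and \<xi> :: "nat \<Rightarrow> 'a \<Rightarrow> real"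
  assumes W: "wiener_process M W" and Jm: "\<And>u. 0 \<le> u \<Longrightarrow> J u \<in> borel_measurable M"
    and WJ: "independent_processes M W J"
    and \<sigma>0: "0 \<le> \<sigma> 0" and \<sigma>: "\<And>i. i < n \<Longrightarrow> \<sigma> i \<le> \<sigma> (Suc i)"
    and \<xi>: "\<And>i. i < n \<Longrightarrow> \<xi> i \<in> borel_measurable (augmented_filtration M W J (\<sigma> i))"
    and bound: "\<And>i. i < n \<Longrightarrow> \<exists>C. \<forall>\<omega>\<in>space M. \<bar>\<xi> i \<omega>\<bar> \<le> C"
    and pos: "0 \<le> \<eta>" "0 < \<epsilon>"
  shows "prob {\<omega>\<in>space M. \<epsilon> < \<bar>\<Sum>i<n. \<xi> i \<omega> * (W (\<sigma> (Suc i)) \<omega> - W (\<sigma> i) \<omega>)\<bar> \<and>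
            (\<Sum>i<n. (\<xi> i \<omega>)\<^sup>2 * (\<sigma> (Suc i) - \<sigma> i)) \<le> \<eta>} \<le> \<eta> / \<epsilon>\<^sup>2"
proof -
  have Wm: "W u \<in> borel_measurable M" if "0 \<le> u" for u
    using W that by (simp add: wiener_process_def)
  let ?F = "augmented_filtration M W J"
  have mono: "i \<le> j \<Longrightarrow> j \<le> n \<Longrightarrow> \<sigma> i \<le> \<sigma> j" for i j
    by (rule mono_upto[of n \<sigma>]) (use \<sigma> in auto)
  define V where "V k \<omega> = (\<Sum>i<k. (\<xi> i \<omega>)\<^sup>2 * (\<sigma> (Suc i) - \<sigma> i))" for k \<omega>
  define \<zeta> where "\<zeta> i \<omega> = (if V (Suc i) \<omega> \<le> \<eta> then \<xi> i \<omega> else 0)" for i \<omega>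
  define Z where "Z \<omega> = (\<Sum>i<n. \<zeta> i \<omega> * (W (\<sigma> (Suc i)) \<omega> - W (\<sigma> i) \<omega>))" for \<omega>
  have \<xi>F: "\<xi> i \<in> borel_measurable (?F (\<sigma> j))" if "i \<le> j" "j < n" for i j
    using \<xi>[of i] mono[of i j] that by (auto intro: measurable_augmented_filtration_mono)
  have VF: "V (Suc i) \<in> borel_measurable (?F (\<sigma> i))" if "i < n" for i
    unfolding V_def using that
    by (intro borel_measurable_sum borel_measurable_times borel_measurable_power \<xi>F) auto
  have \<zeta>F: "\<zeta> i \<in> borel_measurable (?F (\<sigma> i))" if "i < n" for i
    unfolding \<zeta>_def using VF[OF that] \<xi>[OF that] by measurable
  have \<zeta>b: "\<exists>C. \<forall>\<omega>\<in>space M. \<bar>\<zeta> i \<omega>\<bar> \<le> C" if i: "i < n" for i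
  proof -
    obtain C where C: "\<forall>\<omega>\<in>space M. \<bar>\<xi> i \<omega>\<bar> \<le> C" using bound[OF i] by blast
    then have "\<forall>\<omega>\<in>space M. \<bar>\<zeta> i \<omega>\<bar> \<le> \<bar>C\<bar>" by (fastforce simp: \<zeta>_def)
    then show ?thesis by blast
  qed
  have iso: "integrable M (\<lambda>\<omega>. (Z \<omega>)\<^sup>2)"
     "expectation (\<lambda>\<omega>. (Z \<omega>)\<^sup>2) = expectation (\<lambda>\<omega>. \<Sum>i<n. (\<zeta> i \<omega>)\<^sup>2 * (\<sigma> (Suc i) - \<sigma> i))"
    using wiener_grid_isometry[OF W Jm WJ \<sigma>0 \<sigma> \<zeta>F \<zeta>b] unfolding Z_def by blast+
  have Vle: "V i \<omega> \<le> V j \<omega>" if "i \<le> j" "j \<le> n" for i j \<omega>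
    unfolding V_def using that \<sigma> by (intro sum_mono2) auto
  have trunc: "(\<Sum>i<k. (\<zeta> i \<omega>)\<^sup>2 * (\<sigma> (Suc i) - \<sigma> i)) \<le> \<eta>" if "k \<le> n" for k \<omega>
    using that
  proof (induction k)
    case (Suc k)
    show ?case
    proof (cases "V (Suc k) \<omega> \<le> \<eta>")
      case True
      have "(\<Sum>i<Suc k. (\<zeta> i \<omega>)\<^sup>2 * (\<sigma> (Suc i) - \<sigma> i)) \<le> V (Suc k) \<omega>"
        unfolding V_def using \<sigma> Suc.prems
        by (intro sum_mono mult_right_mono) (auto simp: \<zeta>_def)
      with True show ?thesis by linarith
    qed (use Suc in \<open>simp add: \<zeta>_def\<close>)
  qed (use pos in simp)
  have "expectation (\<lambda>\<omega>. (Z \<omega>)\<^sup>2) \<le> \<eta>"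
    unfolding iso(2) using integral_mono'[of M "\<lambda>_. \<eta>"] trunc pos by (simp add: prob_space)
  have "prob {\<omega>\<in>space M. \<epsilon> < \<bar>\<Sum>i<n. \<xi> i \<omega> * (W (\<sigma> (Suc i)) \<omega> - W (\<sigma> i) \<omega>)\<bar> \<and> V n \<omega> \<le> \<eta>}
     \<le> prob {\<omega>\<in>space M. \<epsilon>\<^sup>2 \<le> (Z \<omega>)\<^sup>2}"
  proof (rule finite_measure_mono)
    show "{\<omega>\<in>space M. \<epsilon> < \<bar>\<Sum>i<n. \<xi> i \<omega> * (W (\<sigma> (Suc i)) \<omega> - W (\<sigma> i) \<omega>)\<bar> \<and> V n \<omega> \<le> \<eta>}
      \<subseteq> {\<omega>\<in>space M. \<epsilon>\<^sup>2 \<le> (Z \<omega>)\<^sup>2}"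
    proof safe
      fix \<omega> assume \<omega>: "\<omega> \<in> space M" "V n \<omega> \<le> \<eta>"
        and gt: "\<epsilon> < \<bar>\<Sum>i<n. \<xi> i \<omega> * (W (\<sigma> (Suc i)) \<omega> - W (\<sigma> i) \<omega>)\<bar>"
      have "\<zeta> i \<omega> = \<xi> i \<omega>" if "i < n" for i
        using Vle[of "Suc i" n \<omega>] \<omega>(2) that by (simp add: \<zeta>_def)
      then have "Z \<omega> = (\<Sum>i<n. \<xi> i \<omega> * (W (\<sigma> (Suc i)) \<omega> - W (\<sigma> i) \<omega>))"
        unfolding Z_def by (intro sum.cong) auto
      with gt have "\<epsilon> \<le> \<bar>Z \<omega>\<bar>" by simp
      from power_mono[OF this, of 2] pos show "\<epsilon>\<^sup>2 \<le> (Z \<omega>)\<^sup>2" by simp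
    qed
    show "{\<omega>\<in>space M. \<epsilon>\<^sup>2 \<le> (Z \<omega>)\<^sup>2} \<in> events"
      using borel_measurable_integrable[OF iso(1)] by measurable
  qed
  also have "\<dots> \<le> expectation (\<lambda>\<omega>. (Z \<omega>)\<^sup>2) / \<epsilon>\<^sup>2"
    by (rule integral_Markov_inequality_measure[OF iso(1) sets.empty_sets]) (use pos in auto)
  also have "\<dots> \<le> \<eta> / \<epsilon>\<^sup>2"
    using \<open>expectation (\<lambda>\<omega>. (Z \<omega>)\<^sup>2) \<le> \<eta>\<close> by (intro divide_right_mono) auto
  finally show ?thesis unfolding V_def .
qed

end


section \<open>Lenglart's inequality for the Ito integral\<close>

lemma step_function_square:
  fixes \<tau> :: "nat \<Rightarrow> real" and x :: "nat \<Rightarrow> real"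
  assumes "\<And>i. i < n \<Longrightarrow> \<tau> i \<le> \<tau> (Suc i)"
  shows "(\<Sum>i<n. x i * indicator {\<tau> i<..\<tau> (Suc i)} s)\<^sup>2
       = (\<Sum>i<n. (x i)\<^sup>2 * indicator {\<tau> i<..\<tau> (Suc i)} s)"
  using assms
proof (induction n)
  case (Suc n)
  have "indicator {\<tau> i<..\<tau> (Suc i)} s * indicator {\<tau> n<..\<tau> (Suc n)} s = (0::real)" if "i < n" for i
    using mono_upto[of n \<tau> "Suc i" n] Suc.prems that by (auto simp: indicator_def)
  then have "(\<Sum>i<n. x i * indicator {\<tau> i<..\<tau> (Suc i)} s) * indicator {\<tau> n<..\<tau> (Suc n)} s = 0"
    unfolding sum_distrib_right mult.assoc by (intro sum.neutral ballI) simp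
  moreover have "(indicator {\<tau> n<..\<tau> (Suc n)} s)\<^sup>2 = (indicator {\<tau> n<..\<tau> (Suc n)} s :: real)"
    by (simp add: indicator_def)
  ultimately show ?case using Suc by (auto simp: power2_sum power_mult_distrib)
qed simp

lemma step_function_integral:
  fixes \<tau> :: "nat \<Rightarrow> real" and x :: "nat \<Rightarrow> real"
  assumes \<tau>: "\<And>i. i < n \<Longrightarrow> \<tau> i \<le> \<tau> (Suc i)" and "0 \<le> \<tau> 0"
  shows "set_integrable lborel {0..t} (\<lambda>s. \<Sum>i<n. x i * indicator {\<tau> i<..\<tau> (Suc i)} s)"
    and "(LBINT s:{0..t}. \<Sum>i<n. x i * indicator {\<tau> i<..\<tau> (Suc i)} s)
      = (\<Sum>i<n. x i * (min t (\<tau> (Suc i)) - min t (\<tau> i)))"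
proof -
  have \<tau>0: "0 \<le> \<tau> i" if "i < n" for i
    using mono_upto[of n \<tau> 0 i] \<tau> that assms(2) by simp
  have inter: "{0..t} \<inter> {\<tau> i<..\<tau> (Suc i)} = {\<tau> i<..min t (\<tau> (Suc i))}" if "i < n" for i
    using \<tau>0[OF that] by auto
  have eq: "indicator {0..t} s *\<^sub>R (\<Sum>i<n. x i * indicator {\<tau> i<..\<tau> (Suc i)} s)
     = (\<Sum>i<n. x i * indicator {\<tau> i<..min t (\<tau> (Suc i))} s)" for s
    unfolding real_scaleR_def sum_distrib_left
  proof (intro sum.cong refl)
    fix i assume "i \<in> {..<n}"
    then have "indicator {\<tau> i<..min t (\<tau> (Suc i))} s = (indicator {0..t} s * indicator {\<tau> i<..\<tau> (Suc i)} s :: real)"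
      using inter[of i] by (simp add: indicator_inter_arith[symmetric])
    then show "indicator {0..t} s * (x i * indicator {\<tau> i<..\<tau> (Suc i)} s) = x i * indicator {\<tau> i<..min t (\<tau> (Suc i))} s"
      by simp
  qed
  have int: "integrable lborel (\<lambda>s. x i * indicator {\<tau> i<..min t (\<tau> (Suc i))} s)" for i
  proof (intro integrable_mult_right integrable_real_indicator)
    have "emeasure lborel {\<tau> i<..min t (\<tau> (Suc i))} \<le> emeasure lborel {\<tau> i..max (\<tau> i) t}"
      by (intro emeasure_mono) auto
    also have "\<dots> < \<infinity>" by simp
    finally show "emeasure lborel {\<tau> i<..min t (\<tau> (Suc i))} < \<infinity>" .
  qed simp
  show "set_integrable lborel {0..t} (\<lambda>s. \<Sum>i<n. x i * indicator {\<tau> i<..\<tau> (Suc i)} s)"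
    unfolding set_integrable_def eq using int by (intro Bochner_Integration.integrable_sum)
  have "(LBINT s:{0..t}. \<Sum>i<n. x i * indicator {\<tau> i<..\<tau> (Suc i)} s)
    = (\<Sum>i<n. LBINT s. x i * indicator {\<tau> i<..min t (\<tau> (Suc i))} s)"
    unfolding set_lebesgue_integral_def eq using int by (intro Bochner_Integration.integral_sum)
  also have "\<dots> = (\<Sum>i<n. x i * (min t (\<tau> (Suc i)) - min t (\<tau> i)))"
  proof (intro sum.cong refl)
    fix i assume "i \<in> {..<n}"
    then have "\<tau> i \<le> \<tau> (Suc i)" using \<tau> by simp
    moreover have "(LBINT s. x i * indicator {\<tau> i<..min t (\<tau> (Suc i))} s)
        = x i * measure lborel {\<tau> i<..min t (\<tau> (Suc i))}"
      by simp
    ultimately show "(LBINT s. x i * indicator {\<tau> i<..min t (\<tau> (Suc i))} s)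
        = x i * (min t (\<tau> (Suc i)) - min t (\<tau> i))"
      by (cases "\<tau> i \<le> t") (auto simp: min_def)
  qed
  finally show "(LBINT s:{0..t}. \<Sum>i<n. x i * indicator {\<tau> i<..\<tau> (Suc i)} s)
      = (\<Sum>i<n. x i * (min t (\<tau> (Suc i)) - min t (\<tau> i)))" .
qed

lemma simple_process_square_integrable:
  assumes "simple_integrand F S"
  shows "set_integrable lborel {0..t} (\<lambda>s. (simple_process S s \<omega>)\<^sup>2)"
    and "(\<lambda>s. simple_process S s \<omega>) \<in> borel_measurable borel"
proof -
  obtain n \<tau> \<xi> where S: "S = (n, \<tau>, \<xi>)" by (cases S)
  have \<tau>: "0 \<le> \<tau> 0" "\<And>i. i < n \<Longrightarrow> \<tau> i \<le> \<tau> (Suc i)"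
    using assms by (auto simp: simple_integrand_def S)
  have "(simple_process S s \<omega>)\<^sup>2 = (\<Sum>i<n. (\<xi> i \<omega>)\<^sup>2 * indicator {\<tau> i<..\<tau> (Suc i)} s)" for s
    unfolding S simple_process_def prod.case by (rule step_function_square) (rule \<tau>(2))
  then show "set_integrable lborel {0..t} (\<lambda>s. (simple_process S s \<omega>)\<^sup>2)"
    using step_function_integral(1)[where x = "\<lambda>i. (\<xi> i \<omega>)\<^sup>2", OF \<tau>(2,1)] by simp
  show "(\<lambda>s. simple_process S s \<omega>) \<in> borel_measurable borel"
    unfolding S simple_process_def prod.case by measurable
qed

context prob_space begin

text \<open>
  Cutting the grid at \<open>t\<close> turns the integral up to \<open>t\<close> into a full grid sum. Measurability
  of the event is recorded as well, because the passage to the limit below compares the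
  event of the limit with a union of events up to a null set.
\<close>
lemma simple_integral_lenglart:
  assumes W: "wiener_process M W" and Jm: "\<And>u. 0 \<le> u \<Longrightarrow> J u \<in> borel_measurable M"
    and WJ: "independent_processes M W J"
    and S: "simple_integrand (augmented_filtration M W J) S"
    and pos: "0 \<le> t" "0 \<le> \<eta>" "0 < \<epsilon>"
  shows "{\<omega>\<in>space M. \<epsilon> < \<bar>simple_integral W S t \<omega>\<bar> \<and>
            (LBINT s:{0..t}. (simple_process S s \<omega>)\<^sup>2) \<le> \<eta>} \<in> events" (is ?ev)
    and "prob {\<omega>\<in>space M. \<epsilon> < \<bar>simple_integral W S t \<omega>\<bar> \<and>
            (LBINT s:{0..t}. (simple_process S s \<omega>)\<^sup>2) \<le> \<eta>} \<le> \<eta> / \<epsilon>\<^sup>2" (is ?le)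
proof -
  have Wm: "W u \<in> borel_measurable M" if "0 \<le> u" for u
    using W that by (simp add: wiener_process_def)
  obtain n \<tau> \<xi> where Seq: "S = (n, \<tau>, \<xi>)" by (cases S)
  have \<tau>: "0 \<le> \<tau> 0" "\<And>i. i < n \<Longrightarrow> \<tau> i \<le> \<tau> (Suc i)"
    and \<xi>: "\<And>i. i < n \<Longrightarrow> \<xi> i \<in> borel_measurable (augmented_filtration M W J (\<tau> i))"
    and bound: "\<And>i. i < n \<Longrightarrow> \<exists>C. \<forall>\<omega>\<in>space M. \<bar>\<xi> i \<omega>\<bar> \<le> C"
    using S by (auto simp: simple_integrand_def Seq)
  define \<sigma> where "\<sigma> i = min t (\<tau> i)" for i
  \<comment> \<open>A coefficient whose interval starts after \<open>t\<close> need not be known at time \<open>\<sigma> i = t\<close>;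
      its grid step has collapsed, so it may be replaced by zero.\<close>
  define \<zeta> where "\<zeta> i = (if \<tau> i \<le> t then \<xi> i else (\<lambda>_. 0))" for i
  have \<tau>0: "0 \<le> \<tau> i" if "i \<le> n" for i
    using mono_upto[of n \<tau> 0 i] \<tau> that by simp
  have \<sigma>: "0 \<le> \<sigma> 0" "\<And>i. i < n \<Longrightarrow> \<sigma> i \<le> \<sigma> (Suc i)"
    using \<tau> pos by (auto simp: \<sigma>_def min_le_iff_disj)
  have \<sigma>0: "0 \<le> \<sigma> i" if "i \<le> n" for i using \<tau>0[OF that] pos by (simp add: \<sigma>_def)
  have \<zeta>F: "\<zeta> i \<in> borel_measurable (augmented_filtration M W J (\<sigma> i))" if "i < n" for i
    using \<xi>[OF that] by (auto simp: \<zeta>_def \<sigma>_def min_def)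
  have \<zeta>M: "\<zeta> i \<in> borel_measurable M" if "i < n" for i
    by (rule measurable_augmented_filtration[OF Wm Jm \<zeta>F[OF that]])
  have \<zeta>b: "\<exists>C. \<forall>\<omega>\<in>space M. \<bar>\<zeta> i \<omega>\<bar> \<le> C" if "i < n" for i
    using bound[OF that] by (auto simp: \<zeta>_def)
  have flat: "\<sigma> (Suc i) = \<sigma> i" if "i < n" "\<not> \<tau> i \<le> t" for i
    using \<tau>(2)[OF that(1)] that(2) by (simp add: \<sigma>_def)
  have I: "simple_integral W S t \<omega> = (\<Sum>i<n. \<zeta> i \<omega> * (W (\<sigma> (Suc i)) \<omega> - W (\<sigma> i) \<omega>))" for \<omega>
    unfolding Seq simple_integral_def prod.case \<sigma>_def[symmetric]
    by (intro sum.cong refl) (auto simp: \<zeta>_def flat)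
  have V: "(LBINT s:{0..t}. (simple_process S s \<omega>)\<^sup>2) = (\<Sum>i<n. (\<zeta> i \<omega>)\<^sup>2 * (\<sigma> (Suc i) - \<sigma> i))" for \<omega>
  proof -
    have "(simple_process S s \<omega>)\<^sup>2 = (\<Sum>i<n. (\<xi> i \<omega>)\<^sup>2 * indicator {\<tau> i<..\<tau> (Suc i)} s)" for s
      unfolding Seq simple_process_def prod.case by (rule step_function_square) (rule \<tau>(2))
    then have "(LBINT s:{0..t}. (simple_process S s \<omega>)\<^sup>2)
        = (\<Sum>i<n. (\<xi> i \<omega>)\<^sup>2 * (min t (\<tau> (Suc i)) - min t (\<tau> i)))"
      using step_function_integral(2)[where x = "\<lambda>i. (\<xi> i \<omega>)\<^sup>2", OF \<tau>(2,1)] by simp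
    also have "\<dots> = (\<Sum>i<n. (\<zeta> i \<omega>)\<^sup>2 * (\<sigma> (Suc i) - \<sigma> i))"
      unfolding \<sigma>_def[symmetric] by (intro sum.cong refl) (auto simp: \<zeta>_def flat)
    finally show ?thesis .
  qed
  have 1: "(\<lambda>\<omega>. \<Sum>i<n. \<zeta> i \<omega> * (W (\<sigma> (Suc i)) \<omega> - W (\<sigma> i) \<omega>)) \<in> borel_measurable M"
    using \<sigma>0 by (intro borel_measurable_sum borel_measurable_times borel_measurable_diff \<zeta>M Wm) auto
  have 2: "(\<lambda>\<omega>. \<Sum>i<n. (\<zeta> i \<omega>)\<^sup>2 * (\<sigma> (Suc i) - \<sigma> i)) \<in> borel_measurable M"
    by (intro borel_measurable_sum borel_measurable_times borel_measurable_power \<zeta>M) auto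
  show ?ev unfolding I V using 1 2 by measurable
  show ?le unfolding I V
    by (rule wiener_grid_lenglart[OF W Jm WJ \<sigma> \<zeta>F \<zeta>b pos(2,3)])
qed

text \<open>
  The inequality survives the limit in probability which defines the Ito integral, for every
  integrand with locally square-integrable paths. The weaker constants pay for two
  approximations: \<open>2 * \<epsilon>\<close> leaves room \<open>\<epsilon>\<close> for the error of the integral, and
  \<open>4 * \<eta>\<close> comes from \<open>x\<^sup>2 \<le> 2 (x - y)\<^sup>2 + 2 y\<^sup>2\<close>.
\<close>
lemma ito_integral_lenglart:
  assumes W: "wiener_process M W" and Jm: "\<And>u. 0 \<le> u \<Longrightarrow> J u \<in> borel_measurable M"
    and WJ: "independent_processes M W J"
    and I: "ito_integral M (augmented_filtration M W J) W H I"
    and pos: "0 \<le> t" "0 < \<eta>" "0 < \<epsilon>"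
  shows "prob {\<omega>\<in>space M. 2 * \<epsilon> < \<bar>I t \<omega>\<bar> \<and> (LBINT s:{0..t}. (H s \<omega>)\<^sup>2) \<le> \<eta>} \<le> 4 * \<eta> / \<epsilon>\<^sup>2"
proof -
  let ?F = "augmented_filtration M W J"
  obtain S where S: "\<And>k. simple_integrand ?F (S k)"
    and SH: "tendsto_in_prob M (\<lambda>k \<omega>. LBINT s:{0..t}. (simple_process (S k) s \<omega> - H s \<omega>)\<^sup>2) (\<lambda>_. 0) sequentially"
    and SI: "tendsto_in_prob M (\<lambda>k. simple_integral W (S k) t) (I t) sequentially"
    using I pos(1) unfolding ito_integral_def by blast
  have Hm: "(\<lambda>(s, \<omega>). H s \<omega>) \<in> borel_measurable (restrict_space borel {0..t} \<Otimes>\<^sub>M ?F t)"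
    and Hint: "AE \<omega> in M. set_integrable lborel {0..t} (\<lambda>s. (H s \<omega>)\<^sup>2)"
    using I pos(1) unfolding ito_integral_def progressively_measurable_def by blast+
  have Im: "I t \<in> borel_measurable M" using SI by (simp add: tendsto_in_prob_def)
  define E where "E = {\<omega>\<in>space M. 2 * \<epsilon> < \<bar>I t \<omega>\<bar> \<and> (LBINT s:{0..t}. (H s \<omega>)\<^sup>2) \<le> \<eta>}"
  define E1 where "E1 k = {\<omega>\<in>space M. \<epsilon> < \<bar>simple_integral W (S k) t \<omega> - I t \<omega>\<bar>}" for k
  define E2 where "E2 k = {\<omega>\<in>space M. \<eta> < \<bar>(LBINT s:{0..t}. (simple_process (S k) s \<omega> - H s \<omega>)\<^sup>2) - 0\<bar>}" for k
  define E3 where "E3 k = {\<omega>\<in>space M. \<epsilon> < \<bar>simple_integral W (S k) t \<omega>\<bar> \<and>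
            (LBINT s:{0..t}. (simple_process (S k) s \<omega>)\<^sup>2) \<le> 4 * \<eta>}" for k
  have E3: "E3 k \<in> events" "prob (E3 k) \<le> 4 * \<eta> / \<epsilon>\<^sup>2" for k
    unfolding E3_def using simple_integral_lenglart[OF W Jm WJ S pos(1) _ pos(3)] pos(2) by simp_all
  have split: "AE \<omega> in M. \<omega> \<in> E \<longrightarrow> \<omega> \<in> E1 k \<union> E2 k \<union> E3 k" for k
    using Hint AE_space
  proof eventually_elim
    case (elim \<omega>)
    show ?case
    proof (intro impI, rule ccontr)
      assume E: "\<omega> \<in> E" and not: "\<omega> \<notin> E1 k \<union> E2 k \<union> E3 k"
      let ?X = "\<lambda>s. simple_process (S k) s \<omega>"
      have Hs: "(\<lambda>s. H s \<omega>) \<in> borel_measurable (restrict_space borel {0..t})"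
        using measurable_Pair1[OF Hm, of \<omega>] elim by simp
      have Xs: "?X \<in> borel_measurable (restrict_space borel {0..t})"
        by (rule measurable_restrict_space1) (rule simple_process_square_integrable(2)[OF S])
      have XH: "(\<lambda>s. (?X s - H s \<omega>)\<^sup>2) \<in> borel_measurable (restrict_space borel {0..t})"
        using Hs Xs by simp
      have X2: "set_integrable lborel {0..t} (\<lambda>s. (?X s)\<^sup>2)"
        by (rule simple_process_square_integrable(1)[OF S])
      have sq: "(x - y)\<^sup>2 \<le> 2 * x\<^sup>2 + 2 * y\<^sup>2" for x y :: real
        using zero_le_power2[of "x + y"] by (simp add: power2_eq_square algebra_simps)
      have D: "set_integrable lborel {0..t} (\<lambda>s. 2 * (?X s)\<^sup>2 + 2 * (H s \<omega>)\<^sup>2)"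
        using X2 elim(1) by (intro set_integral_add(1) set_integrable_mult_right)
      have XHi: "set_integrable lborel {0..t} (\<lambda>s. (?X s - H s \<omega>)\<^sup>2)"
      proof (rule set_integrable_bound[OF D])
        show "set_borel_measurable lborel {0..t} (\<lambda>s. (?X s - H s \<omega>)\<^sup>2)"
          using XH unfolding set_borel_measurable_def
          by (subst (asm) borel_measurable_restrict_space_iff) (auto simp: mult.commute)
        show "AE s in lborel. s \<in> {0..t} \<longrightarrow> norm ((?X s - H s \<omega>)\<^sup>2) \<le> norm (2 * (?X s)\<^sup>2 + 2 * (H s \<omega>)\<^sup>2)"
          using sq by (intro AE_I2) (simp add: abs_of_nonneg)
      qed
      have "(LBINT s:{0..t}. (?X s)\<^sup>2) \<le> (LBINT s:{0..t}. 2 * (?X s - H s \<omega>)\<^sup>2 + 2 * (H s \<omega>)\<^sup>2)"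
      proof (rule set_integral_mono[OF X2])
        show "set_integrable lborel {0..t} (\<lambda>s. 2 * (?X s - H s \<omega>)\<^sup>2 + 2 * (H s \<omega>)\<^sup>2)"
          using XHi elim(1) by (intro set_integral_add(1) set_integrable_mult_right)
        show "(?X s)\<^sup>2 \<le> 2 * (?X s - H s \<omega>)\<^sup>2 + 2 * (H s \<omega>)\<^sup>2" for s
          using sq[of "?X s - H s \<omega>" "- H s \<omega>"] by simp
      qed
      also have "\<dots> = 2 * (LBINT s:{0..t}. (?X s - H s \<omega>)\<^sup>2) + 2 * (LBINT s:{0..t}. (H s \<omega>)\<^sup>2)"
        using XHi elim(1) by (simp add: set_integral_add(2))
      also have "\<dots> \<le> 4 * \<eta>"
        using E not elim by (auto simp: E_def E2_def)
      finally show False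
        using E not elim by (auto simp: E_def E1_def E3_def)
    qed
  qed
  have ev: "\<forall>\<^sub>F k in sequentially. prob E \<le> prob (E1 k) + prob (E2 k) + 4 * \<eta> / \<epsilon>\<^sup>2"
  proof -
    have m1: "\<forall>\<^sub>F k in sequentially. simple_integral W (S k) t \<in> borel_measurable M"
      using SI by (simp add: tendsto_in_prob_def)
    have m2: "\<forall>\<^sub>F k in sequentially. (\<lambda>\<omega>. LBINT s:{0..t}. (simple_process (S k) s \<omega> - H s \<omega>)\<^sup>2) \<in> borel_measurable M"
      using SH by (simp add: tendsto_in_prob_def)
    from m1 m2 show ?thesis
    proof eventually_elim
      case (elim k)
      have e1: "E1 k \<in> events" unfolding E1_def using elim(1) Im by measurable
      have e2: "E2 k \<in> events" unfolding E2_def using elim(2) by measurable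
      have "prob E \<le> prob (E1 k \<union> E2 k \<union> E3 k)"
        by (rule finite_measure_mono_AE[OF split]) (use e1 e2 E3 in auto)
      also have "\<dots> \<le> prob (E1 k) + prob (E2 k) + prob (E3 k)"
        using measure_Un_le[of "E1 k \<union> E2 k" M "E3 k"] measure_Un_le[of "E1 k" M "E2 k"] e1 e2 E3(1)[of k]
        by simp
      finally show ?case using E3(2)[of k] by simp
    qed
  qed
  have l1: "(\<lambda>k. prob (E1 k)) \<longlonglongrightarrow> 0" using SI pos by (simp add: tendsto_in_prob_def E1_def)
  have l2: "(\<lambda>k. prob (E2 k)) \<longlonglongrightarrow> 0" using SH pos by (simp add: tendsto_in_prob_def E2_def)
  have "(\<lambda>k. prob (E1 k) + prob (E2 k) + 4 * \<eta> / \<epsilon>\<^sup>2) \<longlonglongrightarrow> 0 + 0 + 4 * \<eta> / \<epsilon>\<^sup>2"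
    by (intro tendsto_intros l1 l2)
  from tendsto_lowerbound[OF this ev] show ?thesis unfolding E_def by simp
qed

end


section \<open>The law of large numbers for subordinators\<close>

lemma tendsto_scaled_exp_minus_one:
  fixes c :: real
  shows "((\<lambda>t. t * (exp (- c / t) - 1)) \<longlongrightarrow> - c) at_top"
proof -
  have "((\<lambda>h. exp (- c * h)) has_real_derivative - c) (at 0)"
    by (auto intro!: derivative_eq_intros)
  then have "((\<lambda>h. (exp (- c * h) - 1) / h) \<longlongrightarrow> - c) (at 0)"
    by (simp add: has_field_derivative_iff)
  moreover have "filterlim (\<lambda>t::real. inverse t) (at 0) at_top"
    using filterlim_inverse_at_right_top by (rule filterlim_mono) (auto simp: at_within_le_at)
  ultimately have "((\<lambda>t. (exp (- c * inverse t) - 1) / inverse t) \<longlongrightarrow> - c) at_top"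
    by (rule filterlim_compose)
  then show ?thesis by (simp add: field_simps)
qed

context prob_space begin

text \<open>
  The exponent of the Laplace transform of \<open>J t / t\<close> is the integral of
  \<open>t * (exp (- c z / t) - 1)\<close> against the Levy measure; it tends to \<open>- c z\<close> pointwise and is
  dominated by \<open>c z\<close>, whose integral is finite.
\<close>
lemma subordinator_scaled_laplace_tendsto:
  assumes m: "sets m = sets borel" and fin: "(\<integral>\<^sup>+z\<in>{0<..}. ennreal z \<partial>m) < \<infinity>"
    and J: "driftless_subordinator M m J" and c: "0 \<le> c"
  shows "((\<lambda>t. expectation (\<lambda>\<omega>. exp (- (c * (J t \<omega> / t))))) \<longlongrightarrow> exp (- (c * (LINT z:{0<..}|m. z)))) at_top"
proof -
  have [measurable]: "{0<..} \<in> sets m" using m by simp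
  have int: "set_integrable m {0<..} (\<lambda>z. z)"
    unfolding set_integrable_def
  proof (rule integrableI_bounded)
    show "(\<lambda>z. indicator {0<..} z *\<^sub>R z) \<in> borel_measurable m"
      unfolding measurable_cong_sets[OF m refl] by measurable
    have "(\<integral>\<^sup>+z. ennreal (norm (indicator {0<..} z *\<^sub>R z)) \<partial>m) = (\<integral>\<^sup>+z\<in>{0<..}. ennreal z \<partial>m)"
      by (intro nn_integral_cong) (auto simp: indicator_def)
    then show "(\<integral>\<^sup>+z. ennreal (norm (indicator {0<..} z *\<^sub>R z)) \<partial>m) < \<infinity>" using fin by simp
  qed
  have laplace: "expectation (\<lambda>\<omega>. exp (- (c * (J t \<omega> / t))))
      = exp (LINT z:{0<..}|m. t * (exp (- (c * z) / t) - 1))" if t: "0 < t" for t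
  proof -
    define u where "u = complex_of_real (- c / t)"
    have "Re u \<le> 0" using c t by (simp add: u_def)
    then have "(LINT \<omega>|M. exp (u * of_real (J t \<omega>)))
          = exp (of_real t * (LINT z:{0<..}|m. exp (u * of_real z) - 1))"
      using J t unfolding driftless_subordinator_def by simp
    moreover have "exp (u * of_real (J t \<omega>)) = complex_of_real (exp (- (c * (J t \<omega> / t))))" for \<omega>
      by (simp add: u_def exp_of_real[symmetric])
    moreover have "(LINT z:{0<..}|m. exp (u * of_real z) - 1)
        = complex_of_real (LINT z:{0<..}|m. exp (- (c * z) / t) - 1)"
    proof -
      have "indicator {0<..} z *\<^sub>R (exp (u * of_real z) - 1)
          = complex_of_real (indicator {0<..} z *\<^sub>R (exp (- (c * z) / t) - 1))" for z
        by (simp add: u_def exp_of_real[symmetric] scaleR_conv_of_real)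
      then show ?thesis
        unfolding set_lebesgue_integral_def by (simp only: integral_complex_of_real)
    qed
    ultimately have "complex_of_real (expectation (\<lambda>\<omega>. exp (- (c * (J t \<omega> / t)))))
        = exp (of_real t * of_real (LINT z:{0<..}|m. exp (- (c * z) / t) - 1))"
      by (simp only: integral_complex_of_real)
    also have "\<dots> = complex_of_real (exp (t * (LINT z:{0<..}|m. exp (- (c * z) / t) - 1)))"
      by (simp add: exp_of_real[symmetric])
    finally show ?thesis by (simp only: of_real_eq_iff set_integral_mult_right)
  qed
  have "((\<lambda>t. LINT z|m. indicator {0<..} z *\<^sub>R (t * (exp (- (c * z) / t) - 1)))
          \<longlongrightarrow> (LINT z|m. indicator {0<..} z *\<^sub>R (- (c * z)))) at_top"
  proof (rule integral_dominated_convergence_at_top)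
    show "(\<lambda>z. indicator {0<..} z *\<^sub>R (t * (exp (- (c * z) / t) - 1))) \<in> borel_measurable m" for t
      unfolding measurable_cong_sets[OF m refl] by measurable
    show "(\<lambda>z. indicator {0<..} z *\<^sub>R (- (c * z))) \<in> borel_measurable m"
      unfolding measurable_cong_sets[OF m refl] by measurable
    show "integrable m (\<lambda>z. c * (indicator {0<..} z *\<^sub>R z))"
      using int unfolding set_integrable_def by (rule integrable_mult_right)
    show "AE z in m. ((\<lambda>t. indicator {0<..} z *\<^sub>R (t * (exp (- (c * z) / t) - 1)))
         \<longlongrightarrow> indicator {0<..} z *\<^sub>R (- (c * z))) at_top"
      by (intro AE_I2 tendsto_scaleR tendsto_const tendsto_scaled_exp_minus_one)
    show "\<forall>\<^sub>F t in at_top. AE z in m. norm (indicator {0<..} z *\<^sub>R (t * (exp (- (c * z) / t) - 1)))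
         \<le> c * (indicator {0<..} z *\<^sub>R z)"
      using eventually_gt_at_top[of 0]
    proof eventually_elim
      case (elim t)
      show ?case
      proof (rule AE_I2)
        fix z
        show "norm (indicator {0<..} z *\<^sub>R (t * (exp (- (c * z) / t) - 1))) \<le> c * (indicator {0<..} z *\<^sub>R z)"
        proof (cases "0 < z")
          case True
          have "1 - exp (- (c * z) / t) \<le> c * z / t" "exp (- (c * z) / t) \<le> 1"
            using exp_ge_add_one_self[of "- (c * z) / t"] c True elim by simp_all
          then have "\<bar>exp (- (c * z) / t) - 1\<bar> \<le> c * z / t" by simp
          from mult_left_mono[OF this, of t] elim have "t * \<bar>exp (- (c * z) / t) - 1\<bar> \<le> c * z" by simp
          with True elim show ?thesis by (simp add: abs_mult)
        qed simp
      qed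
    qed
  qed
  moreover have "(LINT z|m. indicator {0<..} z *\<^sub>R (- (c * z))) = - (c * (LINT z:{0<..}|m. z))"
    unfolding set_lebesgue_integral_def integral_mult_right_zero[symmetric] integral_minus[symmetric]
    by (intro Bochner_Integration.integral_cong) auto
  ultimately have "((\<lambda>t. exp (LINT z:{0<..}|m. t * (exp (- (c * z) / t) - 1)))
        \<longlongrightarrow> exp (- (c * (LINT z:{0<..}|m. z)))) at_top"
    unfolding set_lebesgue_integral_def by (intro tendsto_exp) simp
  then show ?thesis
    by (rule Lim_transform_eventually)
       (use eventually_gt_at_top[of 0] in eventually_elim, simp only: laplace)
qed

text \<open>
  Jumps need not have a second moment, so Chebyshev's inequality is applied to the bounded
  variables \<open>Z t = exp (- (J t / t))\<close>. Their first two moments are values of the Laplace transform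
  at \<open>1\<close> and \<open>2\<close>, and converge to \<open>c\<close> and \<open>c\<^sup>2\<close> with \<open>c = exp (- \<mu>)\<close>. Hence \<open>Z t\<close> tends to
  \<open>c\<close> in mean square, and taking logarithms gives the claim.
\<close>
lemma subordinator_law_of_large_numbers:
  assumes m: "sets m = sets borel" and fin: "(\<integral>\<^sup>+z\<in>{0<..}. ennreal z \<partial>m) < \<infinity>"
    and J: "driftless_subordinator M m J"
  shows "tendsto_in_prob M (\<lambda>t \<omega>. J t \<omega> / t) (\<lambda>_. LINT z:{0<..}|m. z) at_top"
proof -
  let ?\<mu> = "LINT z:{0<..}|m. z"
  have Jm: "J t \<in> borel_measurable M" if "0 \<le> t" for t
    using J that by (simp add: driftless_subordinator_def levy_process_def)
  have pos: "AE \<omega> in M. 0 \<le> J t \<omega>" if "0 \<le> t" for t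
  proof -
    have "AE \<omega> in M. J 0 \<omega> = 0" "AE \<omega> in M. mono_on {0..} (\<lambda>t. J t \<omega>)"
      using J by (auto simp: driftless_subordinator_def levy_process_def)
    then show ?thesis
    proof eventually_elim
      case (elim \<omega>)
      then show ?case using mono_onD[OF elim(2), of 0 t] that by simp
    qed
  qed
  define Z where "Z t \<omega> = exp (- (J t \<omega> / t))" for t \<omega>
  define c where "c = exp (- ?\<mu>)"
  have Zm: "Z t \<in> borel_measurable M" if "0 < t" for t
    using Jm[of t] that unfolding Z_def by simp
  have Zint: "integrable M (Z t)" "integrable M (\<lambda>\<omega>. (Z t \<omega>)\<^sup>2)" if t: "0 < t" for t
  proof -
    have b: "AE \<omega> in M. Z t \<omega> \<le> 1" using pos[of t] t by (auto simp: Z_def)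
    have Z0: "0 \<le> Z t \<omega>" for \<omega> by (simp add: Z_def)
    show "integrable M (Z t)"
      using b Z0 by (intro integrable_const_bound[of _ 1] Zm t) auto
    have "AE \<omega> in M. norm ((Z t \<omega>)\<^sup>2) \<le> 1"
      using b by eventually_elim (use Z0 in \<open>simp add: power_le_one\<close>)
    then show "integrable M (\<lambda>\<omega>. (Z t \<omega>)\<^sup>2)"
      using Zm[OF t] by (intro integrable_const_bound[of _ 1]) auto
  qed
  have E1: "((\<lambda>t. expectation (Z t)) \<longlongrightarrow> c) at_top"
    using subordinator_scaled_laplace_tendsto[OF m fin J, of 1] by (simp add: Z_def[abs_def] c_def)
  have E2: "((\<lambda>t. expectation (\<lambda>\<omega>. (Z t \<omega>)\<^sup>2)) \<longlongrightarrow> c\<^sup>2) at_top"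
  proof -
    have "(Z t \<omega>)\<^sup>2 = exp (- (2 * (J t \<omega> / t)))" for t \<omega>
      by (simp add: Z_def power2_eq_square exp_add[symmetric])
    moreover have "c\<^sup>2 = exp (- (2 * ?\<mu>))" by (simp add: c_def power2_eq_square exp_add[symmetric])
    ultimately show ?thesis using subordinator_scaled_laplace_tendsto[OF m fin J, of 2] by simp
  qed
  have "((\<lambda>t. expectation (\<lambda>\<omega>. (Z t \<omega>)\<^sup>2) - 2 * c * expectation (Z t) + c\<^sup>2) \<longlongrightarrow> c\<^sup>2 - 2 * c * c + c\<^sup>2) at_top"
    by (intro tendsto_intros E1 E2)
  then have L2: "((\<lambda>t. expectation (\<lambda>\<omega>. (Z t \<omega>)\<^sup>2) - 2 * c * expectation (Z t) + c\<^sup>2) \<longlongrightarrow> 0) at_top"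
    by (simp add: power2_eq_square)
  have "((\<lambda>t. prob {\<omega>\<in>space M. \<epsilon> < \<bar>J t \<omega> / t - ?\<mu>\<bar>}) \<longlongrightarrow> 0) at_top" if \<epsilon>: "0 < \<epsilon>" for \<epsilon>
  proof -
    \<comment> \<open>The distance from \<open>exp (- \<mu>)\<close> to \<open>exp (- (\<mu> + \<epsilon>))\<close>; by convexity the point
        \<open>\<mu> - \<epsilon>\<close> on the other side is mapped even further away.\<close>
    define \<delta> where "\<delta> = c * (1 - exp (- \<epsilon>))"
    have \<delta>: "0 < \<delta>" using \<epsilon> by (simp add: \<delta>_def c_def)
    have bound: "prob {\<omega>\<in>space M. \<epsilon> < \<bar>J t \<omega> / t - ?\<mu>\<bar>}
        \<le> (expectation (\<lambda>\<omega>. (Z t \<omega>)\<^sup>2) - 2 * c * expectation (Z t) + c\<^sup>2) / \<delta>\<^sup>2" if t: "0 < t" for t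
    proof -
      have far: "\<delta> \<le> \<bar>exp (- x) - c\<bar>" if "\<epsilon> < \<bar>x - ?\<mu>\<bar>" for x
      proof (cases "?\<mu> < x")
        case True
        then have "exp (- x) \<le> exp (- ?\<mu> - \<epsilon>)" using that by simp
        also have "\<dots> = c * exp (- \<epsilon>)" by (simp add: c_def exp_add[symmetric])
        finally show ?thesis by (simp add: \<delta>_def algebra_simps)
      next
        case False
        have "1 - exp (- \<epsilon>) \<le> exp \<epsilon> - 1"
          using exp_ge_add_one_self[of \<epsilon>] exp_ge_add_one_self[of "- \<epsilon>"] by linarith
        then have "\<delta> \<le> c * (exp \<epsilon> - 1)" unfolding \<delta>_def by (intro mult_left_mono) (simp_all add: c_def)
        also have "\<dots> = exp (- ?\<mu> + \<epsilon>) - c" by (simp add: c_def algebra_simps exp_add[symmetric])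
        also have "\<dots> \<le> exp (- x) - c" using that False by simp
        finally show ?thesis by simp
      qed
      have exp: "(Z t \<omega> - c)\<^sup>2 = (Z t \<omega>)\<^sup>2 - 2 * c * Z t \<omega> + c\<^sup>2" for \<omega>
        by (simp add: power2_diff)
      have int: "integrable M (\<lambda>\<omega>. (Z t \<omega> - c)\<^sup>2)"
        unfolding exp using Zint[OF t] by simp
      have "prob {\<omega>\<in>space M. \<epsilon> < \<bar>J t \<omega> / t - ?\<mu>\<bar>} \<le> prob {\<omega>\<in>space M. \<delta>\<^sup>2 \<le> (Z t \<omega> - c)\<^sup>2}"
      proof (rule finite_measure_mono)
        show "{\<omega>\<in>space M. \<epsilon> < \<bar>J t \<omega> / t - ?\<mu>\<bar>} \<subseteq> {\<omega>\<in>space M. \<delta>\<^sup>2 \<le> (Z t \<omega> - c)\<^sup>2}"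
        proof safe
          fix \<omega> assume "\<epsilon> < \<bar>J t \<omega> / t - ?\<mu>\<bar>"
          from power_mono[OF far[OF this], of 2] \<delta> show "\<delta>\<^sup>2 \<le> (Z t \<omega> - c)\<^sup>2" by (simp add: Z_def)
        qed
        show "{\<omega>\<in>space M. \<delta>\<^sup>2 \<le> (Z t \<omega> - c)\<^sup>2} \<in> events" using Zm[OF t] by measurable
      qed
      also have "\<dots> \<le> expectation (\<lambda>\<omega>. (Z t \<omega> - c)\<^sup>2) / \<delta>\<^sup>2"
        by (rule integral_Markov_inequality_measure[OF int sets.empty_sets]) (use \<delta> in auto)
      also have "expectation (\<lambda>\<omega>. (Z t \<omega> - c)\<^sup>2)
          = expectation (\<lambda>\<omega>. (Z t \<omega>)\<^sup>2) - 2 * c * expectation (Z t) + c\<^sup>2"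
        unfolding exp using Zint[OF t] by (simp add: prob_space)
      finally show ?thesis .
    qed
    have lim: "((\<lambda>t. (expectation (\<lambda>\<omega>. (Z t \<omega>)\<^sup>2) - 2 * c * expectation (Z t) + c\<^sup>2) / \<delta>\<^sup>2) \<longlongrightarrow> 0) at_top"
      using tendsto_divide[OF L2 tendsto_const[of "\<delta>\<^sup>2"]] \<delta> by simp
    have ev: "\<forall>\<^sub>F t in at_top. prob {\<omega>\<in>space M. \<epsilon> < \<bar>J t \<omega> / t - ?\<mu>\<bar>}
        \<le> (expectation (\<lambda>\<omega>. (Z t \<omega>)\<^sup>2) - 2 * c * expectation (Z t) + c\<^sup>2) / \<delta>\<^sup>2"
      using eventually_gt_at_top[of 0] by eventually_elim (rule bound)
    show ?thesis
      by (rule tendsto_sandwich[OF always_eventually ev tendsto_const lim]) simp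
  qed
  moreover have "\<forall>\<^sub>F t in at_top. (\<lambda>\<omega>. J t \<omega> / t) \<in> borel_measurable M"
    using eventually_gt_at_top[of 0] by eventually_elim (use Jm in simp)
  ultimately show ?thesis unfolding tendsto_in_prob_def by simp
qed

end


section \<open>The stochastic integral is negligible\<close>

lemma tendsto_in_probD:
  assumes "tendsto_in_prob M X Z G" "0 < \<epsilon>"
  shows "((\<lambda>i. \<P>(\<omega> in M. \<epsilon> < \<bar>X i \<omega> - Z \<omega>\<bar>)) \<longlongrightarrow> 0) G"
  using assms unfolding tendsto_in_prob_def by blast

context prob_space begin

text \<open>
  A tail bound for \<open>A\<close> out of a circular estimate. Here \<open>c * A\<close> is the quadratic variation of
  \<open>I\<close>, and \<open>A\<close> is in turn controlled by \<open>I\<close>: where \<open>g\<close> is moderate, a large \<open>A\<close> forces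
  \<open>I\<close> to be at least of the order of \<open>A\<close>, whereas Lenglart's inequality makes \<open>I\<close>
  of the order of the square root of \<open>A\<close>. On the dyadic shell where \<open>A\<close> lies between
  \<open>2 ^ n * L\<close> and twice that, both sides have a definite size, so the shell has probability of
  order \<open>1 / (2 ^ n * L)\<close>. These probabilities form a geometric series over \<open>n\<close>.
\<close>
lemma peeling_bound:
  assumes m: "A \<in> borel_measurable M" "g \<in> borel_measurable M" "I \<in> borel_measurable M"
    and pos: "0 < b" "0 < c" "0 < L"
    and lenglart: "\<And>\<epsilon> \<eta>. 0 < \<epsilon> \<Longrightarrow> 0 < \<eta> \<Longrightarrow> prob {\<omega>\<in>space M. 2 * \<epsilon> < \<bar>I \<omega>\<bar> \<and> c * A \<omega> \<le> \<eta>} \<le> 4 * \<eta> / \<epsilon>\<^sup>2"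
    and le: "AE \<omega> in M. b * A \<omega> \<le> g \<omega> + I \<omega>"
  shows "prob {\<omega>\<in>space M. L < A \<omega> \<and> g \<omega> \<le> b * L / 2} \<le> 256 * c / (b\<^sup>2 * L)"
proof -
  note [measurable] = m
  define K where "K = 128 * c / (b\<^sup>2 * L)"
  define B where "B n = {\<omega>\<in>space M. 2 ^ n * L < A \<omega> \<and> A \<omega> \<le> 2 ^ Suc n * L \<and> g \<omega> \<le> b * L / 2}" for n :: nat
  have Bm: "B n \<in> events" for n unfolding B_def by measurable
  have shell: "prob (B n) \<le> K * (1/2) ^ n" for n
  proof -
    define \<epsilon> where "\<epsilon> = b * (2 ^ n * L) / 4"
    define \<eta> where "\<eta> = c * (2 ^ Suc n * L)"
    have p: "0 < \<epsilon>" "0 < \<eta>" using pos by (auto simp: \<epsilon>_def \<eta>_def)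
    have "prob (B n) \<le> prob {\<omega>\<in>space M. 2 * \<epsilon> < \<bar>I \<omega>\<bar> \<and> c * A \<omega> \<le> \<eta>}"
    proof (rule finite_measure_mono_AE)
      show "AE \<omega> in M. \<omega> \<in> B n \<longrightarrow> \<omega> \<in> {\<omega>\<in>space M. 2 * \<epsilon> < \<bar>I \<omega>\<bar> \<and> c * A \<omega> \<le> \<eta>}"
        using le
      proof eventually_elim
        case (elim \<omega>)
        show ?case
        proof
          assume B: "\<omega> \<in> B n"
          have "b * (2 ^ n * L) < b * A \<omega>" using B pos by (simp add: B_def)
          moreover have "b * L \<le> b * (2 ^ n * L)" using pos by simp
          moreover have "g \<omega> \<le> b * L / 2" using B by (simp add: B_def)
          ultimately have "b * (2 ^ n * L) / 2 < I \<omega>" using elim by linarith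
          moreover have "2 * \<epsilon> = b * (2 ^ n * L) / 2" by (simp add: \<epsilon>_def)
          ultimately have "2 * \<epsilon> < \<bar>I \<omega>\<bar>" by linarith
          moreover have "c * A \<omega> \<le> \<eta>" using B pos unfolding \<eta>_def by (intro mult_left_mono) (auto simp: B_def)
          ultimately show "\<omega> \<in> {\<omega>\<in>space M. 2 * \<epsilon> < \<bar>I \<omega>\<bar> \<and> c * A \<omega> \<le> \<eta>}" using B by (simp add: B_def)
        qed
      qed
    qed measurable
    also have "\<dots> \<le> 4 * \<eta> / \<epsilon>\<^sup>2" by (rule lenglart[OF p])
    also have "\<dots> = K * (1/2) ^ n"
    proof -
      define q :: real where "q = 2 ^ n"
      have q: "q > 0" by (simp add: q_def)
      have "4 * \<eta> / \<epsilon>\<^sup>2 = K * (1 / q)"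
        unfolding \<eta>_def \<epsilon>_def K_def power_Suc q_def[symmetric] using q pos
        by (simp add: field_simps power2_eq_square)
      then show ?thesis by (simp add: q_def power_one_over)
    qed
    finally show ?thesis .
  qed
  have geo: "(\<lambda>n. K * (1/2) ^ n) sums (K * 2)"
    using sums_mult[OF geometric_sums[of "1/2 :: real"], of K] by simp
  have summ: "summable (\<lambda>n. prob (B n))"
    by (rule summable_comparison_test'[OF sums_summable[OF geo]]) (use shell in simp)
  have sub: "{\<omega>\<in>space M. L < A \<omega> \<and> g \<omega> \<le> b * L / 2} \<subseteq> (\<Union>n. B n)"
  proof safe
    fix \<omega> assume \<omega>: "\<omega> \<in> space M" "L < A \<omega>" "g \<omega> \<le> b * L / 2"
    obtain N :: nat where "A \<omega> / L < 2 ^ N" using real_arch_pow[of 2 "A \<omega> / L"] by auto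
    then have ex: "A \<omega> \<le> 2 ^ N * L" using pos by (simp add: field_simps)
    define k where "k = (LEAST k. A \<omega> \<le> 2 ^ k * L)"
    have k: "A \<omega> \<le> 2 ^ k * L" unfolding k_def by (rule LeastI[of _ N]) (rule ex)
    have "k \<noteq> 0" using k \<omega>(2) by (metis leD mult_1 power_0)
    then obtain n where n: "k = Suc n" using not0_implies_Suc by blast
    have "\<not> A \<omega> \<le> 2 ^ n * L" by (rule not_less_Least) (simp add: n[symmetric] k_def[symmetric], simp add: n)
    then have "\<omega> \<in> B n" using k n \<omega> by (simp add: B_def)
    then show "\<omega> \<in> (\<Union>n. B n)" by blast
  qed
  have "prob {\<omega>\<in>space M. L < A \<omega> \<and> g \<omega> \<le> b * L / 2} \<le> prob (\<Union>n. B n)"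
    using sub Bm by (intro finite_measure_mono) auto
  also have "\<dots> \<le> (\<Sum>n. prob (B n))"
    using Bm summ by (intro finite_measure_subadditive_countably) auto
  also have "\<dots> \<le> (\<Sum>n. K * (1/2) ^ n)"
    using shell summ geo by (intro suminf_le) (auto simp: sums_iff)
  also have "\<dots> = 256 * c / (b\<^sup>2 * L)" using geo by (simp add: sums_iff K_def)
  finally show ?thesis .
qed

text \<open>
  With high probability \<open>A t \<le> K t\<close> for a constant \<open>K\<close>: this is the peeling bound,
  once the law of large numbers keeps \<open>J t\<close> below \<open>(\<bar>\<mu>\<bar> + 1) t\<close>. Lenglart's inequality
  then makes \<open>I t\<close> of the order of \<open>sqrt t\<close>.
\<close>
lemma noise_negligible:
  assumes m: "\<And>t. 0 \<le> t \<Longrightarrow> A t \<in> borel_measurable M" "\<And>t. 0 \<le> t \<Longrightarrow> J t \<in> borel_measurable M"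
      "\<And>t. 0 \<le> t \<Longrightarrow> I t \<in> borel_measurable M"
    and pos: "0 < b" "0 < c" "0 \<le> a" "0 \<le> y0"
    and lenglart: "\<And>t \<epsilon> \<eta>. 0 \<le> t \<Longrightarrow> 0 < \<epsilon> \<Longrightarrow> 0 < \<eta> \<Longrightarrow>
        prob {\<omega>\<in>space M. 2 * \<epsilon> < \<bar>I t \<omega>\<bar> \<and> c * A t \<omega> \<le> \<eta>} \<le> 4 * \<eta> / \<epsilon>\<^sup>2"
    and le: "\<And>t. 0 \<le> t \<Longrightarrow> AE \<omega> in M. b * A t \<omega> \<le> y0 + a * t + J t \<omega> + I t \<omega>"
    and J: "tendsto_in_prob M (\<lambda>t \<omega>. J t \<omega> / t) (\<lambda>_. \<mu>) at_top"
  shows "tendsto_in_prob M (\<lambda>t \<omega>. I t \<omega> / t) (\<lambda>_. 0) at_top"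
proof -
  \<comment> \<open>For \<open>t \<ge> 1\<close> the threshold \<open>b * (K * t) / 2\<close> of the peeling bound then dominates
      \<open>y0 + a * t + J t\<close>, unless \<open>J t / t\<close> is further than \<open>1\<close> from its limit.\<close>
  define K where "K = 2 * (y0 + a + \<bar>\<mu>\<bar> + 1) / b"
  have K: "0 < K" "b * K = 2 * (y0 + a + \<bar>\<mu>\<bar> + 1)" using pos by (simp_all add: K_def add_nonneg_pos)
  have bound: "prob {\<omega>\<in>space M. \<epsilon> < \<bar>I t \<omega> / t - 0\<bar>}
      \<le> 16 * c * K / \<epsilon>\<^sup>2 * inverse t + 256 * c / (b\<^sup>2 * K) * inverse t + prob {\<omega>\<in>space M. 1 < \<bar>J t \<omega> / t - \<mu>\<bar>}"
    if \<epsilon>: "0 < \<epsilon>" and t: "1 \<le> t" for \<epsilon> t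
  proof -
    have t0: "0 \<le> t" using t by simp
    note [measurable] = m(1)[OF t0] m(2)[OF t0] m(3)[OF t0]
    define E1 where "E1 = {\<omega>\<in>space M. 2 * (\<epsilon> * t / 2) < \<bar>I t \<omega>\<bar> \<and> c * A t \<omega> \<le> c * (K * t)}"
    define E2 where "E2 = {\<omega>\<in>space M. K * t < A t \<omega> \<and> y0 + a * t + J t \<omega> \<le> b * (K * t) / 2}"
    define E3 where "E3 = {\<omega>\<in>space M. 1 < \<bar>J t \<omega> / t - \<mu>\<bar>}"
    have ev: "E1 \<in> events" "E2 \<in> events" "E3 \<in> events"
      unfolding E1_def E2_def E3_def by (measurable, measurable, measurable)
    have "prob E1 \<le> 4 * (c * (K * t)) / (\<epsilon> * t / 2)\<^sup>2"
      unfolding E1_def by (rule lenglart) (use t \<epsilon> K pos in simp_all)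
    also have "\<dots> = 16 * c * K / \<epsilon>\<^sup>2 * inverse t" using t \<epsilon> by (simp add: field_simps power2_eq_square)
    finally have P1: "prob E1 \<le> 16 * c * K / \<epsilon>\<^sup>2 * inverse t" .
    have "prob E2 \<le> 256 * c / (b\<^sup>2 * (K * t))"
      unfolding E2_def
    proof (rule peeling_bound)
      show "A t \<in> borel_measurable M" "I t \<in> borel_measurable M" by (measurable, measurable)
      show "(\<lambda>\<omega>. y0 + a * t + J t \<omega>) \<in> borel_measurable M" by measurable
      show "0 < b" "0 < c" "0 < K * t" using pos K t by simp_all
      show "AE \<omega> in M. b * A t \<omega> \<le> y0 + a * t + J t \<omega> + I t \<omega>" by (rule le[OF t0])
      show "prob {\<omega>\<in>space M. 2 * \<epsilon> < \<bar>I t \<omega>\<bar> \<and> c * A t \<omega> \<le> \<eta>} \<le> 4 * \<eta> / \<epsilon>\<^sup>2"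
        if "0 < \<epsilon>" "0 < \<eta>" for \<epsilon> \<eta> by (rule lenglart[OF t0 that])
    qed
    also have "\<dots> = 256 * c / (b\<^sup>2 * K) * inverse t" by (simp add: field_simps)
    finally have P2: "prob E2 \<le> 256 * c / (b\<^sup>2 * K) * inverse t" .
    have "prob {\<omega>\<in>space M. \<epsilon> < \<bar>I t \<omega> / t - 0\<bar>} \<le> prob (E1 \<union> E2 \<union> E3)"
    proof (rule finite_measure_mono)
      show "{\<omega>\<in>space M. \<epsilon> < \<bar>I t \<omega> / t - 0\<bar>} \<subseteq> E1 \<union> E2 \<union> E3"
      proof (rule subsetI, rule ccontr)
        fix \<omega> assume "\<omega> \<in> {\<omega>\<in>space M. \<epsilon> < \<bar>I t \<omega> / t - 0\<bar>}" and not: "\<omega> \<notin> E1 \<union> E2 \<union> E3"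
        then have \<omega>: "\<omega> \<in> space M" and "\<epsilon> < \<bar>I t \<omega>\<bar> / t" using t by simp_all
        then have "2 * (\<epsilon> * t / 2) < \<bar>I t \<omega>\<bar>" using t by (simp add: field_simps)
        with not \<omega> have "\<not> c * A t \<omega> \<le> c * (K * t)" by (simp add: E1_def)
        then have "K * t < A t \<omega>" using pos by simp
        with not \<omega> have "b * (K * t) / 2 < y0 + a * t + J t \<omega>" by (simp add: E2_def)
        moreover have "b * (K * t) / 2 = (y0 + a + \<bar>\<mu>\<bar> + 1) * t"
          using K(2) by (simp add: mult.assoc[symmetric])
        moreover have "y0 \<le> y0 * t" using t pos by (simp add: mult_le_cancel_left1)
        ultimately have "(\<bar>\<mu>\<bar> + 1) * t < J t \<omega>" by (simp add: algebra_simps)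
        then have "\<bar>\<mu>\<bar> + 1 < J t \<omega> / t" using t by (simp add: field_simps)
        then have "1 < \<bar>J t \<omega> / t - \<mu>\<bar>" by linarith
        with not \<omega> show False by (simp add: E3_def)
      qed
    qed (use ev in auto)
    also have "\<dots> \<le> prob E1 + prob E2 + prob E3"
      using measure_Un_le[of "E1 \<union> E2" M E3] measure_Un_le[of E1 M E2] ev by simp
    finally show ?thesis using P1 P2 unfolding E3_def by linarith
  qed
  have conv: "((\<lambda>t. prob {\<omega>\<in>space M. \<epsilon> < \<bar>I t \<omega> / t - 0\<bar>}) \<longlongrightarrow> 0) at_top" if \<epsilon>: "0 < \<epsilon>" for \<epsilon>
  proof -
    have "((\<lambda>t. prob {\<omega>\<in>space M. 1 < \<bar>J t \<omega> / t - \<mu>\<bar>}) \<longlongrightarrow> 0) at_top"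
      by (rule tendsto_in_probD[OF J]) simp
    then have "((\<lambda>t. 16 * c * K / \<epsilon>\<^sup>2 * inverse t + 256 * c / (b\<^sup>2 * K) * inverse t
       + prob {\<omega>\<in>space M. 1 < \<bar>J t \<omega> / t - \<mu>\<bar>}) \<longlongrightarrow> 16 * c * K / \<epsilon>\<^sup>2 * 0 + 256 * c / (b\<^sup>2 * K) * 0 + 0) at_top"
      by (intro tendsto_intros tendsto_inverse_0_at_top filterlim_ident)
    then have lim: "((\<lambda>t. 16 * c * K / \<epsilon>\<^sup>2 * inverse t + 256 * c / (b\<^sup>2 * K) * inverse t
       + prob {\<omega>\<in>space M. 1 < \<bar>J t \<omega> / t - \<mu>\<bar>}) \<longlongrightarrow> 0) at_top" by simp
    have ev: "\<forall>\<^sub>F t in at_top. prob {\<omega>\<in>space M. \<epsilon> < \<bar>I t \<omega> / t - 0\<bar>}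
      \<le> 16 * c * K / \<epsilon>\<^sup>2 * inverse t + 256 * c / (b\<^sup>2 * K) * inverse t + prob {\<omega>\<in>space M. 1 < \<bar>J t \<omega> / t - \<mu>\<bar>}"
      using eventually_ge_at_top[of 1] by eventually_elim (rule bound[OF \<epsilon>])
    show ?thesis
      by (rule tendsto_sandwich[OF always_eventually ev tendsto_const lim]) simp
  qed
  have meas: "\<forall>\<^sub>F t in at_top. (\<lambda>\<omega>. I t \<omega> / t) \<in> borel_measurable M"
    using eventually_ge_at_top[of 0] by eventually_elim (use m in simp)
  show ?thesis unfolding tendsto_in_prob_def using conv meas by simp
qed

lemma affine_noise_tendsto:
  assumes I: "tendsto_in_prob M (\<lambda>t \<omega>. I t \<omega> / t) (\<lambda>_. 0) at_top"
    and J: "tendsto_in_prob M (\<lambda>t \<omega>. J t \<omega> / t) (\<lambda>_. \<mu>) at_top"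
    and m: "\<And>t. 0 \<le> t \<Longrightarrow> I t \<in> borel_measurable M" "\<And>t. 0 \<le> t \<Longrightarrow> J t \<in> borel_measurable M"
  shows "tendsto_in_prob M (\<lambda>t \<omega>. (y0 + a * t + I t \<omega> + J t \<omega>) / t) (\<lambda>_. a + \<mu>) at_top"
proof -
  have conv: "((\<lambda>t. prob {\<omega>\<in>space M. \<epsilon> < \<bar>(y0 + a * t + I t \<omega> + J t \<omega>) / t - (a + \<mu>)\<bar>}) \<longlongrightarrow> 0) at_top"
    if \<epsilon>: "0 < \<epsilon>" for \<epsilon>
  proof -
    define E1 where "E1 t = {\<omega>\<in>space M. \<epsilon> / 3 < \<bar>I t \<omega> / t - 0\<bar>}" for t
    define E2 where "E2 t = {\<omega>\<in>space M. \<epsilon> / 3 < \<bar>J t \<omega> / t - \<mu>\<bar>}" for t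
    have "((\<lambda>t. prob (E1 t) + prob (E2 t)) \<longlongrightarrow> 0 + 0) at_top"
      unfolding E1_def E2_def by (intro tendsto_add tendsto_in_probD[OF I] tendsto_in_probD[OF J]) (use \<epsilon> in simp_all)
    then have lim: "((\<lambda>t. prob (E1 t) + prob (E2 t)) \<longlongrightarrow> 0) at_top" by simp
    have "((\<lambda>t. y0 * inverse t) \<longlongrightarrow> y0 * 0) at_top"
      by (intro tendsto_intros tendsto_inverse_0_at_top filterlim_ident)
    then have "((\<lambda>t. \<bar>y0 * inverse t\<bar>) \<longlongrightarrow> 0) at_top" using tendsto_rabs_zero by simp
    from order_tendstoD(2)[OF this, of "\<epsilon> / 3"] \<epsilon>
    have small: "\<forall>\<^sub>F t in at_top. \<bar>y0 * inverse t\<bar> < \<epsilon> / 3" by simp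
    have ev: "\<forall>\<^sub>F t in at_top. prob {\<omega>\<in>space M. \<epsilon> < \<bar>(y0 + a * t + I t \<omega> + J t \<omega>) / t - (a + \<mu>)\<bar>}
        \<le> prob (E1 t) + prob (E2 t)"
      using small eventually_gt_at_top[of 0]
    proof eventually_elim
      case (elim t)
      have [measurable]: "I t \<in> borel_measurable M" "J t \<in> borel_measurable M" using m elim by simp_all
      have ev: "E1 t \<in> events" "E2 t \<in> events" unfolding E1_def E2_def by (measurable, measurable)
      have "prob {\<omega>\<in>space M. \<epsilon> < \<bar>(y0 + a * t + I t \<omega> + J t \<omega>) / t - (a + \<mu>)\<bar>} \<le> prob (E1 t \<union> E2 t)"
      proof (rule finite_measure_mono)
        show "{\<omega>\<in>space M. \<epsilon> < \<bar>(y0 + a * t + I t \<omega> + J t \<omega>) / t - (a + \<mu>)\<bar>} \<subseteq> E1 t \<union> E2 t"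
        proof (rule subsetI, rule ccontr)
          fix \<omega> assume "\<omega> \<in> {\<omega>\<in>space M. \<epsilon> < \<bar>(y0 + a * t + I t \<omega> + J t \<omega>) / t - (a + \<mu>)\<bar>}"
            and not: "\<omega> \<notin> E1 t \<union> E2 t"
          then have \<omega>: "\<omega> \<in> space M" and big: "\<epsilon> < \<bar>(y0 + a * t + I t \<omega> + J t \<omega>) / t - (a + \<mu>)\<bar>" by simp_all
          have "(y0 + a * t + I t \<omega> + J t \<omega>) / t - (a + \<mu>) = y0 * inverse t + I t \<omega> / t + (J t \<omega> / t - \<mu>)"
            using elim(2) by (simp add: field_simps)
          moreover have "\<bar>I t \<omega> / t\<bar> \<le> \<epsilon> / 3" "\<bar>J t \<omega> / t - \<mu>\<bar> \<le> \<epsilon> / 3" using not \<omega> by (simp_all add: E1_def E2_def not_less)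
          ultimately show False using big elim(1) by linarith
        qed
      qed (use ev in auto)
      also have "\<dots> \<le> prob (E1 t) + prob (E2 t)" by (rule measure_Un_le[OF ev])
      finally show ?case .
    qed
    show ?thesis
      by (rule tendsto_sandwich[OF always_eventually ev tendsto_const lim]) simp
  qed
  have meas: "\<forall>\<^sub>F t in at_top. (\<lambda>\<omega>. (y0 + a * t + I t \<omega> + J t \<omega>) / t) \<in> borel_measurable M"
    using eventually_ge_at_top[of 0] by eventually_elim (use m in simp)
  show ?thesis unfolding tendsto_in_prob_def using conv meas by simp
qed

end


section \<open>Time averages in a relaxation equation\<close>

text \<open>
  Progressive measurability speaks of the time interval \<open>{0..t}\<close> and of the sigma-algebra at
  \<open>t\<close>. Clamping the time to \<open>{0..t}\<close> transfers it to the whole time axis and to \<open>M\<close>, which is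
  the form in which Fubini's theorem needs it.
\<close>
lemma progressively_measurable_clamped:
  fixes H :: "real \<Rightarrow> 'a \<Rightarrow> real"
  assumes prog: "progressively_measurable F H" and t: "0 \<le> t"
    and F: "space (F t) = space M" "sets (F t) \<subseteq> sets M"
  shows "(\<lambda>(\<omega>, s). indicator {0..t} s * H s \<omega>) \<in> borel_measurable (M \<Otimes>\<^sub>M lborel)"
proof -
  have H: "(\<lambda>(s, \<omega>). H s \<omega>) \<in> borel_measurable (restrict_space borel {0..t} \<Otimes>\<^sub>M F t)"
    using prog t unfolding progressively_measurable_def by blast
  have id: "(\<lambda>\<omega>. \<omega>) \<in> M \<rightarrow>\<^sub>M F t"
    using F by (intro measurableI) (auto dest: sets.sets_into_space simp: Int_absorb2)
  have "(\<lambda>p. max 0 (min t (snd p))) \<in> M \<Otimes>\<^sub>M lborel \<rightarrow>\<^sub>M restrict_space borel {0..t}"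
    using t by (intro measurable_restrict_space2) auto
  moreover have "(\<lambda>p. fst p) \<in> M \<Otimes>\<^sub>M lborel \<rightarrow>\<^sub>M F t"
    by (rule measurable_compose[OF measurable_fst id])
  ultimately have "(\<lambda>p. (max 0 (min t (snd p)), fst p)) \<in> M \<Otimes>\<^sub>M lborel \<rightarrow>\<^sub>M restrict_space borel {0..t} \<Otimes>\<^sub>M F t"
    by (rule measurable_Pair)
  from measurable_compose[OF this H]
  have "(\<lambda>p. H (max 0 (min t (snd p))) (fst p)) \<in> borel_measurable (M \<Otimes>\<^sub>M lborel)" by simp
  then have "(\<lambda>p. indicator {0..t} (snd p) * H (max 0 (min t (snd p))) (fst p)) \<in> borel_measurable (M \<Otimes>\<^sub>M lborel)"
    by (intro borel_measurable_times measurable_compose[OF measurable_snd] borel_measurable_indicator) auto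
  also have "(\<lambda>p. indicator {0..t} (snd p) * H (max 0 (min t (snd p))) (fst p)) = (\<lambda>(\<omega>, s). indicator {0..t} s * H s \<omega>)"
    by (auto simp: fun_eq_iff indicator_def max_def min_def)
  finally show ?thesis .
qed

context prob_space begin

text \<open>
  If on \<open>D\<close> the process \<open>Y\<close> is at least \<open>c\<close> at every single time of a window of length \<open>h\<close>,
  up to exceptional events \<open>B s\<close> of small probability, then by Fubini's theorem its integral
  has expectation at least \<open>c * h * (prob D - p)\<close> over \<open>D\<close>. The exceptional event may
  depend on the time \<open>s\<close>, so estimates at single times suffice.
\<close>
lemma occupation_lower_bound:
  fixes Y :: "real \<Rightarrow> 'a \<Rightarrow> real"
  assumes jm: "(\<lambda>(\<omega>, s). indicator {0..t} s * Y s \<omega>) \<in> borel_measurable (M \<Otimes>\<^sub>M lborel)"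
    and h: "0 < h" "h \<le> t" and c: "0 \<le> c"
    and int: "AE \<omega> in M. set_integrable lborel {0..t} (\<lambda>s. Y s \<omega>)"
    and nonneg: "AE \<omega> in M. \<forall>s\<ge>0. 0 \<le> Y s \<omega>"
    and D: "D \<in> events" and B: "\<And>s. s \<in> {t - h..t} \<Longrightarrow> B s \<in> events"
    and pB: "\<And>s. s \<in> {t - h..t} \<Longrightarrow> prob (B s) \<le> p"
    and low: "\<And>s. s \<in> {t - h..t} \<Longrightarrow> AE \<omega> in M. \<omega> \<in> D \<longrightarrow> \<omega> \<notin> B s \<longrightarrow> c \<le> Y s \<omega>"
    and up: "AE \<omega> in M. \<omega> \<in> D \<longrightarrow> (LBINT s:{0..t}. Y s \<omega>) \<le> C" and C: "0 \<le> C"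
  shows "c * h * (prob D - p) \<le> C * prob D"
proof -
  interpret L: pair_sigma_finite M lborel
    unfolding pair_sigma_finite_def using sigma_finite_measure_axioms lborel.sigma_finite_measure_axioms by simp
  have ind [measurable]: "(indicator {t - h..t} :: real \<Rightarrow> ennreal) \<in> borel_measurable lborel" by simp
  let ?f = "\<lambda>\<omega> s. ennreal (indicator {0..t} s * Y s \<omega>) * indicator {t - h..t} s * indicator D \<omega>"
  have fm: "case_prod ?f \<in> borel_measurable (M \<Otimes>\<^sub>M lborel)"
  proof -
    have 1: "(\<lambda>p. indicator {0..t} (snd p) * Y (snd p) (fst p)) \<in> borel_measurable (M \<Otimes>\<^sub>M lborel)"
      using jm by (simp add: case_prod_beta')
    have 2: "(\<lambda>p. indicator D (fst p) :: ennreal) \<in> borel_measurable (M \<Otimes>\<^sub>M lborel)"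
      using D by (intro measurable_compose[OF measurable_fst] borel_measurable_indicator)
    show ?thesis
      unfolding case_prod_beta'
      by (intro borel_measurable_times_ennreal measurable_compose[OF 1 measurable_ennreal]
          measurable_compose[OF measurable_snd ind] 2)
  qed
  have "ennreal (c * h * (prob D - p)) \<le> (\<integral>\<^sup>+s. ennreal (c * (prob D - p)) * indicator {t - h..t} s \<partial>lborel)"
  proof -
    have "(\<integral>\<^sup>+s. ennreal (c * (prob D - p)) * indicator {t - h..t} s \<partial>lborel)
        = ennreal (c * (prob D - p)) * emeasure lborel {t - h..t}"
      by (rule nn_integral_cmult_indicator) simp
    also have "\<dots> = ennreal (c * (prob D - p) * h)" using h by (simp add: ennreal_mult'')
    also have "c * (prob D - p) * h = c * h * (prob D - p)" by simp
    finally show ?thesis by simp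
  qed
  also have "\<dots> \<le> (\<integral>\<^sup>+s. (\<integral>\<^sup>+\<omega>. ?f \<omega> s \<partial>M) \<partial>lborel)"
  proof (rule nn_integral_mono)
    fix s :: real
    show "ennreal (c * (prob D - p)) * indicator {t - h..t} s \<le> (\<integral>\<^sup>+\<omega>. ?f \<omega> s \<partial>M)"
    proof (cases "s \<in> {t - h..t}")
      case True
      then have s: "s \<in> {0..t}" using h by auto
      have "prob D \<le> prob ((D - B s) \<union> B s)"
        using B[OF True] D by (intro finite_measure_mono) auto
      also have "\<dots> \<le> prob (D - B s) + prob (B s)"
        using B[OF True] D by (intro measure_Un_le) auto
      finally have "prob D - p \<le> prob (D - B s)" using pB[OF True] by simp
      then have "ennreal (c * (prob D - p)) \<le> ennreal (c * prob (D - B s))"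
        using c by (intro ennreal_leI mult_left_mono)
      also have "\<dots> = (\<integral>\<^sup>+\<omega>. ennreal c * indicator (D - B s) \<omega> \<partial>M)"
        using D B[OF True] c by (simp add: nn_integral_cmult_indicator emeasure_eq_measure ennreal_mult)
      also have "\<dots> \<le> (\<integral>\<^sup>+\<omega>. ?f \<omega> s \<partial>M)"
        using low[OF True]
        by (intro nn_integral_mono_AE, eventually_elim)
           (use True s in \<open>auto simp: indicator_def intro: ennreal_leI\<close>)
      finally show ?thesis using True by simp
    qed simp
  qed
  also have "\<dots> = (\<integral>\<^sup>+\<omega>. (\<integral>\<^sup>+s. ?f \<omega> s \<partial>lborel) \<partial>M)"
    by (rule L.Fubini'[OF fm])
  also have "\<dots> \<le> (\<integral>\<^sup>+\<omega>. ennreal C * indicator D \<omega> \<partial>M)"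
  proof (rule nn_integral_mono_AE)
    show "AE \<omega> in M. (\<integral>\<^sup>+s. ?f \<omega> s \<partial>lborel) \<le> ennreal C * indicator D \<omega>"
      using int nonneg up
    proof eventually_elim
      case (elim \<omega>)
      show ?case
      proof (cases "\<omega> \<in> D")
        case True
        have "(\<integral>\<^sup>+s. ?f \<omega> s \<partial>lborel) \<le> (\<integral>\<^sup>+s. ennreal (indicator {0..t} s * Y s \<omega>) \<partial>lborel)"
          by (intro nn_integral_mono) (auto simp: indicator_def)
        also have "\<dots> = ennreal (LBINT s:{0..t}. Y s \<omega>)"
          using elim(1,2) unfolding set_integrable_def set_lebesgue_integral_def real_scaleR_def
          by (intro nn_integral_eq_integral AE_I2) (auto simp: indicator_def)
        also have "\<dots> \<le> ennreal C" using elim(3) True by (intro ennreal_leI) simp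
        finally show ?thesis using True by simp
      qed simp
    qed
  qed
  also have "\<dots> = ennreal (C * prob D)"
    using D C by (simp add: nn_integral_cmult_indicator emeasure_eq_measure ennreal_mult)
  finally show ?thesis using C by (simp add: ennreal_le_iff)
qed

text \<open>
  Integrating \<open>Y + b A = R\<close>, where \<open>A\<close> is the integral of \<open>Y\<close>. As \<open>Y\<close> is non-negative,
  \<open>b A \<le> R\<close>, which is the upper bound. For the lower bound suppose that \<open>b A t\<close> falls short
  of \<open>\<rho> t\<close> by \<open>\<delta> t\<close>. Since \<open>A\<close> is non-decreasing, it has been that small throughout the window
  \<open>{t - h..t}\<close>, so that \<open>Y = R - b A\<close> must have been at least \<open>\<delta> t / 2\<close> at most times in it.
  A window whose length \<open>h\<close> is a large constant then makes \<open>A t\<close> exceed \<open>\<rho> t / b\<close>, a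
  contradiction.
\<close>
lemma time_average_tendsto:
  fixes Y R :: "real \<Rightarrow> 'a \<Rightarrow> real"
  assumes jm: "\<And>t. 0 \<le> t \<Longrightarrow> (\<lambda>(\<omega>, s). indicator {0..t} s * Y s \<omega>) \<in> borel_measurable (M \<Otimes>\<^sub>M lborel)"
    and int: "\<And>t. 0 \<le> t \<Longrightarrow> AE \<omega> in M. set_integrable lborel {0..t} (\<lambda>s. Y s \<omega>)"
    and nonneg: "AE \<omega> in M. \<forall>s\<ge>0. 0 \<le> Y s \<omega>"
    and Rm: "\<And>t. 0 \<le> t \<Longrightarrow> R t \<in> borel_measurable M"
    and eq: "\<And>t. 0 \<le> t \<Longrightarrow> AE \<omega> in M. Y t \<omega> + b * (LBINT s:{0..t}. Y s \<omega>) = R t \<omega>"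
    and R: "tendsto_in_prob M (\<lambda>t \<omega>. R t \<omega> / t) (\<lambda>_. \<rho>) at_top"
    and b: "0 < b" and \<rho>: "0 \<le> \<rho>"
  shows "tendsto_in_prob M (\<lambda>t \<omega>. 1 / t * (LBINT s:{0..t}. Y s \<omega>)) (\<lambda>_. \<rho> / b) at_top"
proof -
  define A where "A t \<omega> = (LBINT s:{0..t}. Y s \<omega>)" for t \<omega>
  have Am: "A t \<in> borel_measurable M" if "0 \<le> t" for t
    using lborel.borel_measurable_lebesgue_integral[OF jm[OF that]]
    by (simp add: A_def[abs_def] set_lebesgue_integral_def)
  have mono: "AE \<omega> in M. A s \<omega> \<le> A t \<omega>" if "0 \<le> s" "s \<le> t" for s t
  proof -
    have "AE \<omega> in M. set_integrable lborel {0..t} (\<lambda>s. Y s \<omega>)" using int that by simp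
    with nonneg show ?thesis
    proof eventually_elim
      case (elim \<omega>)
      have i: "set_integrable lborel {0..s} (\<lambda>s. Y s \<omega>)"
        by (rule set_integrable_subset[OF elim(2)]) (use that in auto)
      show ?case
        unfolding A_def set_lebesgue_integral_def
        by (rule integral_mono[OF i[unfolded set_integrable_def] elim(2)[unfolded set_integrable_def]])
           (use elim(1) that in \<open>auto simp: indicator_def\<close>)
    qed
  qed
  have conv: "((\<lambda>t. prob {\<omega>\<in>space M. \<epsilon> < \<bar>1 / t * A t \<omega> - \<rho> / b\<bar>}) \<longlongrightarrow> 0) at_top" if \<epsilon>: "0 < \<epsilon>" for \<epsilon>
  proof (rule tendstoI)
    fix p :: real assume p: "0 < p"
    define \<delta> where "\<delta> = b * \<epsilon>"
    have \<delta>: "0 < \<delta>" using b \<epsilon> by (simp add: \<delta>_def)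
    \<comment> \<open>Chosen such that \<open>\<delta> * h / 4\<close>, half of what the window contributes per unit of \<open>t\<close>,
        is at least \<open>\<rho> / b\<close>.\<close>
    define h where "h = 4 * \<rho> / (b * \<delta>) + 1"
    have h: "0 < h" using b \<rho> \<delta> by (simp add: h_def add_nonneg_pos)
    define B where "B s = {\<omega>\<in>space M. \<delta> / 4 < \<bar>R s \<omega> / s - \<rho>\<bar>}" for s
    have Bm: "B s \<in> events" if "0 \<le> s" for s
      unfolding B_def using Rm[OF that] by measurable
    have "((\<lambda>s. prob (B s)) \<longlongrightarrow> 0) at_top"
      unfolding B_def by (rule tendsto_in_probD[OF R]) (use \<delta> in simp)
    from order_tendstoD(2)[OF this, of "p / 4"] p
    obtain T0 where T0: "\<And>s. T0 \<le> s \<Longrightarrow> prob (B s) < p / 4"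
      by (auto simp: eventually_at_top_linorder)
    have "prob {\<omega>\<in>space M. \<epsilon> < \<bar>1 / t * A t \<omega> - \<rho> / b\<bar>} < p"
      if t: "max T0 1 + h + 4 * \<rho> * h / \<delta> \<le> t" for t
    proof -
      have "0 \<le> 4 * \<rho> * h / \<delta>" using \<rho> h \<delta> by simp
      then have th: "max T0 1 + h \<le> t" using t by linarith
      have tpos: "0 < t" "h \<le> t" using th h by linarith+
      have ht: "\<rho> * h \<le> \<delta> * t / 4"
      proof -
        have "4 * \<rho> * h / \<delta> \<le> t" using t h by linarith
        then show ?thesis using \<delta> by (simp add: field_simps)
      qed
      have win: "T0 \<le> s" "0 < s" "s \<le> t" "t - h \<le> s" if "s \<in> {t - h..t}" for s
        using th that by auto
      define D where "D = {\<omega>\<in>space M. b * A t \<omega> < (\<rho> - \<delta>) * t}"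
      define U where "U = {\<omega>\<in>space M. (\<rho> + \<delta>) * t < b * A t \<omega>}"
      have [measurable]: "A t \<in> borel_measurable M" using Am tpos by simp
      have Dm: "D \<in> events" unfolding D_def by measurable
      have Um: "U \<in> events" unfolding U_def by measurable
      have "prob U \<le> prob (B t)"
      proof (rule finite_measure_mono_AE)
        have "AE \<omega> in M. Y t \<omega> + b * A t \<omega> = R t \<omega>" using eq[of t] tpos by (simp add: A_def)
        with nonneg show "AE \<omega> in M. \<omega> \<in> U \<longrightarrow> \<omega> \<in> B t"
        proof eventually_elim
          case (elim \<omega>)
          show ?case
          proof
            assume U: "\<omega> \<in> U"
            have "0 \<le> Y t \<omega>" using elim(1) tpos by simp
            then have "(\<rho> + \<delta>) * t < R t \<omega>" using U elim(2) by (simp add: U_def)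
            then have "\<rho> + \<delta> < R t \<omega> / t" using tpos by (simp add: field_simps)
            then have "\<delta> / 4 < \<bar>R t \<omega> / t - \<rho>\<bar>" using \<delta> by linarith
            then show "\<omega> \<in> B t" using U by (simp add: B_def U_def)
          qed
        qed
      qed (use Bm tpos in simp)
      moreover have "T0 \<le> t" using th h by linarith
      ultimately have PU: "prob U < p / 4" using T0[of t] by linarith
      have "\<delta> * t / 2 * h * (prob D - p / 4) \<le> \<rho> * t / b * prob D"
      proof (rule occupation_lower_bound[OF jm])
        show "0 \<le> t" "h \<le> t" "0 < h" using tpos h by auto
        show "0 \<le> \<delta> * t / 2" "0 \<le> \<rho> * t / b" using tpos \<delta> \<rho> b by simp_all
        show "AE \<omega> in M. set_integrable lborel {0..t} (\<lambda>s. Y s \<omega>)" using int tpos by simp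
        show "AE \<omega> in M. \<forall>s\<ge>0. 0 \<le> Y s \<omega>" by fact
        show "D \<in> events" by fact
        show "B s \<in> events" "prob (B s) \<le> p / 4" if "s \<in> {t - h..t}" for s
          using win[OF that] Bm[of s] T0[of s] by simp_all
        show "AE \<omega> in M. \<omega> \<in> D \<longrightarrow> (LBINT s:{0..t}. Y s \<omega>) \<le> \<rho> * t / b"
        proof (rule AE_I2, rule impI)
          fix \<omega> assume "\<omega> \<in> D"
          then have "b * A t \<omega> < (\<rho> - \<delta>) * t" by (simp add: D_def)
          also have "\<dots> \<le> \<rho> * t" using \<delta> tpos by (intro mult_right_mono) auto
          finally show "(LBINT s:{0..t}. Y s \<omega>) \<le> \<rho> * t / b"
            using b by (simp add: A_def field_simps)
        qed
        fix s assume s: "s \<in> {t - h..t}"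
        note w = win[OF s]
        have "AE \<omega> in M. A s \<omega> \<le> A t \<omega>" using mono w by simp
        moreover have "AE \<omega> in M. Y s \<omega> + b * A s \<omega> = R s \<omega>" using eq[of s] w by (simp add: A_def)
        ultimately show "AE \<omega> in M. \<omega> \<in> D \<longrightarrow> \<omega> \<notin> B s \<longrightarrow> \<delta> * t / 2 \<le> Y s \<omega>"
        proof eventually_elim
          case (elim \<omega>)
          show ?case
          proof (intro impI)
            assume D: "\<omega> \<in> D" and "\<omega> \<notin> B s"
            then have "\<bar>R s \<omega> / s - \<rho>\<bar> \<le> \<delta> / 4" by (simp add: B_def D_def)
            then have "\<rho> - \<delta> / 4 \<le> R s \<omega> / s" by linarith
            then have "\<rho> * s - \<delta> * s / 4 \<le> R s \<omega>" using w by (simp add: field_simps)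
            moreover have "\<rho> * t - \<rho> * h \<le> \<rho> * s"
              using mult_left_mono[OF w(4) \<rho>] by (simp add: algebra_simps)
            moreover have "\<delta> * s \<le> \<delta> * t" using w \<delta> by simp
            ultimately have "\<rho> * t - \<delta> * t / 2 \<le> R s \<omega>" using ht by linarith
            moreover have "b * A s \<omega> \<le> b * A t \<omega>" using elim(1) b by simp
            moreover have "b * A t \<omega> < \<rho> * t - \<delta> * t" using D by (simp add: D_def algebra_simps)
            ultimately show "\<delta> * t / 2 \<le> Y s \<omega>" using elim(2) by linarith
          qed
        qed
      qed
      then have "t * (\<delta> * h / 2 * (prob D - p / 4)) \<le> t * (\<rho> / b * prob D)" by (simp add: algebra_simps)
      then have "\<delta> * h / 2 * (prob D - p / 4) \<le> \<rho> / b * prob D"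
        by (rule mult_left_le_imp_le) (use tpos in simp)
      also have "\<dots> \<le> \<delta> * h / 4 * prob D"
        using b \<delta> by (intro mult_right_mono) (auto simp: h_def field_simps)
      finally have "\<delta> * h * (2 * (prob D - p / 4)) \<le> \<delta> * h * prob D"
        by (simp add: algebra_simps)
      then have "2 * (prob D - p / 4) \<le> prob D"
        by (rule mult_left_le_imp_le) (use \<delta> h in simp)
      then have PD: "prob D \<le> p / 2" by simp
      have "prob {\<omega>\<in>space M. \<epsilon> < \<bar>1 / t * A t \<omega> - \<rho> / b\<bar>} \<le> prob (U \<union> D)"
      proof (rule finite_measure_mono)
        show "{\<omega>\<in>space M. \<epsilon> < \<bar>1 / t * A t \<omega> - \<rho> / b\<bar>} \<subseteq> U \<union> D"
        proof safe
          fix \<omega> assume \<omega>: "\<omega> \<in> space M" "\<omega> \<notin> D" and "\<epsilon> < \<bar>1 / t * A t \<omega> - \<rho> / b\<bar>"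
          then have "b * t * \<epsilon> < b * t * \<bar>1 / t * A t \<omega> - \<rho> / b\<bar>" using b tpos by simp
          also have "\<dots> = \<bar>b * t * (1 / t * A t \<omega> - \<rho> / b)\<bar>" using b tpos by (simp add: abs_mult)
          also have "b * t * (1 / t * A t \<omega> - \<rho> / b) = b * A t \<omega> - \<rho> * t" using b tpos by (simp add: field_simps)
          finally have "\<delta> * t < \<bar>b * A t \<omega> - \<rho> * t\<bar>" by (simp add: \<delta>_def mult_ac)
          then show "\<omega> \<in> U" using \<omega> by (auto simp: U_def D_def algebra_simps abs_if split: if_splits)
        qed
      qed (use Um Dm in auto)
      also have "\<dots> \<le> prob U + prob D" by (rule measure_Un_le[OF Um Dm])
      also have "\<dots> < p" using PU PD p by linarith
      finally show ?thesis .
    qed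
    then show "\<forall>\<^sub>F t in at_top. dist (prob {\<omega>\<in>space M. \<epsilon> < \<bar>1 / t * A t \<omega> - \<rho> / b\<bar>}) 0 < p"
      unfolding eventually_at_top_linorder by (auto intro!: exI[of _ "max T0 1 + h + 4 * \<rho> * h / \<delta>"])
  qed
  have meas: "\<forall>\<^sub>F t in at_top. (\<lambda>\<omega>. 1 / t * A t \<omega>) \<in> borel_measurable M"
    using eventually_ge_at_top[of 0] by eventually_elim (use Am in simp)
  show ?thesis
    unfolding A_def[symmetric] tendsto_in_prob_def using conv meas by simp
qed

end


section \<open>The jump-type CIR process\<close>

theorem theorem5p1:
  fixes M :: "'a measure"
    and W J Y :: "real \<Rightarrow> 'a \<Rightarrow> real"
    and m :: "real measure"
    and a b \<sigma> y0 :: real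
  assumes "prob_space M"
    and "0 \<le> a" and "0 < b" and "0 < \<sigma>" and "0 \<le> y0"
    and "levy_measure_on_pos m"
    and "(\<integral>\<^sup>+z\<in>{0<..}. ennreal z \<partial>m) < \<infinity>"
    and "wiener_process M W"
    and "driftless_subordinator M m J"
    and "independent_processes M W J"
    and "strong_solution M W J a b \<sigma> Y"
    and "\<P>(\<omega> in M. Y 0 \<omega> = y0) = 1"
  shows "tendsto_in_prob M
           (\<lambda>t \<omega>. 1 / t * (LBINT s:{0..t}. Y s \<omega>))
           (\<lambda>_. 1 / b * (a + (LINT z:{0<..}|m. z)))
           at_top
         \<and> 1 / b * (a + (LINT z:{0<..}|m. z)) \<in> {0..}"
proof -
  interpret prob_space M by fact
  let ?F = "augmented_filtration M W J"
  define \<mu> where "\<mu> = (LINT z:{0<..}|m. z)"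
  have Wm: "W t \<in> borel_measurable M" if "0 \<le> t" for t
    using assms(8) that by (simp add: wiener_process_def)
  have Jm: "J t \<in> borel_measurable M" if "0 \<le> t" for t
    using assms(9) that by (simp add: driftless_subordinator_def levy_process_def)
  have \<mu>0: "0 \<le> \<mu>"
    unfolding \<mu>_def set_lebesgue_integral_def by (intro Bochner_Integration.integral_nonneg) (auto simp: indicator_def)
  have prog: "progressively_measurable ?F Y" and nonneg: "AE \<omega> in M. \<forall>t\<ge>0. 0 \<le> Y t \<omega>"
    using assms(11) by (auto simp: strong_solution_def)
  obtain I where I: "ito_integral M ?F W (\<lambda>t \<omega>. \<sigma> * sqrt (Y t \<omega>)) I"
    and sde: "AE \<omega> in M. \<forall>t\<ge>0. Y t \<omega> = Y 0 \<omega> + (LBINT s:{0..t}. a - b * Y s \<omega>) + I t \<omega> + J t \<omega>"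
    using assms(11) unfolding strong_solution_def by blast
  have Im: "I t \<in> borel_measurable M" if "0 \<le> t" for t
  proof (rule measurable_augmented_filtration[OF Wm Jm])
    show "I t \<in> borel_measurable (?F t)" using I that unfolding ito_integral_def by blast
  qed
  define A where "A t \<omega> = (LBINT s:{0..t}. Y s \<omega>)" for t \<omega>
  have jm: "(\<lambda>(\<omega>, s). indicator {0..t} s * Y s \<omega>) \<in> borel_measurable (M \<Otimes>\<^sub>M lborel)" if "0 \<le> t" for t
    by (rule progressively_measurable_clamped[OF prog that])
       (simp_all add: sets_augmented_filtration_le Wm Jm)
  have Am: "A t \<in> borel_measurable M" if "0 \<le> t" for t
    using lborel.borel_measurable_lebesgue_integral[OF jm[OF that]]
    by (simp add: A_def[abs_def] set_lebesgue_integral_def)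
  have sq: "AE \<omega> in M. \<forall>s\<ge>0. (\<sigma> * sqrt (Y s \<omega>))\<^sup>2 = \<sigma>\<^sup>2 * Y s \<omega>"
    using nonneg by eventually_elim (simp add: power_mult_distrib)
  have int: "AE \<omega> in M. set_integrable lborel {0..t} (\<lambda>s. Y s \<omega>)" if "0 \<le> t" for t
  proof -
    have "AE \<omega> in M. set_integrable lborel {0..t} (\<lambda>s. (\<sigma> * sqrt (Y s \<omega>))\<^sup>2)"
      using I that unfolding ito_integral_def by blast
    with sq show ?thesis
    proof eventually_elim
      case (elim \<omega>)
      have "set_integrable lborel {0..t} (\<lambda>s. \<sigma>\<^sup>2 * Y s \<omega>)"
        by (rule iffD1[OF set_integrable_cong elim(2)]) (use elim(1) in auto)
      then show ?case using assms(4) by simp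
    qed
  qed
  have lenglart: "prob {\<omega>\<in>space M. 2 * \<epsilon> < \<bar>I t \<omega>\<bar> \<and> \<sigma>\<^sup>2 * A t \<omega> \<le> \<eta>} \<le> 4 * \<eta> / \<epsilon>\<^sup>2"
    if t: "0 \<le> t" and p: "0 < \<epsilon>" "0 < \<eta>" for t \<epsilon> \<eta>
  proof -
    let ?Q = "\<lambda>\<omega>. LBINT s:{0..t}. (\<sigma> * sqrt (Y s \<omega>))\<^sup>2"
    have "\<sigma>\<^sup>2 * A t \<omega> = ?Q \<omega>" if "\<forall>s\<ge>0. (\<sigma> * sqrt (Y s \<omega>))\<^sup>2 = \<sigma>\<^sup>2 * Y s \<omega>" for \<omega>
    proof -
      have "?Q \<omega> = (LBINT s:{0..t}. \<sigma>\<^sup>2 * Y s \<omega>)"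
        by (rule set_lebesgue_integral_cong) (use that in auto)
      then show ?thesis by (simp add: A_def)
    qed
    then have eq: "AE \<omega> in M. \<sigma>\<^sup>2 * A t \<omega> = ?Q \<omega>" using sq by (auto elim: eventually_mono)
    have Qm: "?Q \<in> borel_measurable M"
    proof -
      have "progressively_measurable ?F (\<lambda>t \<omega>. (\<sigma> * sqrt (Y t \<omega>))\<^sup>2)"
        using prog unfolding progressively_measurable_def case_prod_beta'
        by (auto intro!: borel_measurable_power borel_measurable_times borel_measurable_sqrt)
      then have "(\<lambda>(\<omega>, s). indicator {0..t} s * (\<sigma> * sqrt (Y s \<omega>))\<^sup>2) \<in> borel_measurable (M \<Otimes>\<^sub>M lborel)"
        by (rule progressively_measurable_clamped[OF _ t])
           (simp_all add: sets_augmented_filtration_le Wm Jm)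
      from lborel.borel_measurable_lebesgue_integral[OF this] show ?thesis
        by (simp add: set_lebesgue_integral_def)
    qed
    have "prob {\<omega>\<in>space M. 2 * \<epsilon> < \<bar>I t \<omega>\<bar> \<and> \<sigma>\<^sup>2 * A t \<omega> \<le> \<eta>} \<le> prob {\<omega>\<in>space M. 2 * \<epsilon> < \<bar>I t \<omega>\<bar> \<and> ?Q \<omega> \<le> \<eta>}"
    proof (rule finite_measure_mono_AE)
      show "AE \<omega> in M. \<omega> \<in> {\<omega>\<in>space M. 2 * \<epsilon> < \<bar>I t \<omega>\<bar> \<and> \<sigma>\<^sup>2 * A t \<omega> \<le> \<eta>} \<longrightarrow>
          \<omega> \<in> {\<omega>\<in>space M. 2 * \<epsilon> < \<bar>I t \<omega>\<bar> \<and> ?Q \<omega> \<le> \<eta>}"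
        using eq by eventually_elim simp
      show "{\<omega>\<in>space M. 2 * \<epsilon> < \<bar>I t \<omega>\<bar> \<and> ?Q \<omega> \<le> \<eta>} \<in> events"
        using Im[OF t] Qm by measurable
    qed
    also have "\<dots> \<le> 4 * \<eta> / \<epsilon>\<^sup>2"
      by (rule ito_integral_lenglart[OF assms(8) Jm assms(10) I t p(2,1)])
    finally show ?thesis .
  qed
  have start: "AE \<omega> in M. Y 0 \<omega> = y0"
    using AE_prob_1[OF assms(12)] by eventually_elim simp
  have eq: "AE \<omega> in M. Y t \<omega> + b * A t \<omega> = y0 + a * t + I t \<omega> + J t \<omega>" if t: "0 \<le> t" for t
    using sde start int[OF t]
  proof eventually_elim
    case (elim \<omega>)
    have ia: "set_integrable lborel {0..t} (\<lambda>_. a)"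
      unfolding set_integrable_def by (intro integrable_scaleR_left integrable_real_indicator)
         (use t in auto)
    have "(LBINT s:{0..t}. a - b * Y s \<omega>) = (LBINT s:{0..t}. a) - (LBINT s:{0..t}. b * Y s \<omega>)"
      using elim(3) by (intro set_integral_diff(2) ia) simp
    also have "(LBINT s:{0..t}. a) = a * t" using t by (simp add: set_lebesgue_integral_def)
    also have "(LBINT s:{0..t}. b * Y s \<omega>) = b * A t \<omega>" by (simp add: A_def)
    finally show ?case using elim(1,2) t by (simp add: algebra_simps)
  qed
  have J: "tendsto_in_prob M (\<lambda>t \<omega>. J t \<omega> / t) (\<lambda>_. \<mu>) at_top"
    unfolding \<mu>_def using assms(6)
    by (intro subordinator_law_of_large_numbers[OF _ assms(7,9)]) (simp add: levy_measure_on_pos_def)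
  have It: "tendsto_in_prob M (\<lambda>t \<omega>. I t \<omega> / t) (\<lambda>_. 0) at_top"
  proof (rule noise_negligible[where b = b and c = "\<sigma>\<^sup>2" and a = a and ?y0.0 = y0, OF Am Jm Im])
    show "AE \<omega> in M. b * A t \<omega> \<le> y0 + a * t + J t \<omega> + I t \<omega>" if t: "0 \<le> t" for t
      using eq[OF t] nonneg by eventually_elim (use t in force)
    show "prob {\<omega>\<in>space M. 2 * \<epsilon> < \<bar>I t \<omega>\<bar> \<and> \<sigma>\<^sup>2 * A t \<omega> \<le> \<eta>} \<le> 4 * \<eta> / \<epsilon>\<^sup>2"
      if "0 \<le> t" "0 < \<epsilon>" "0 < \<eta>" for t \<epsilon> \<eta> by (rule lenglart[OF that])
  qed (use assms J in simp_all)
  have "tendsto_in_prob M (\<lambda>t \<omega>. 1 / t * (LBINT s:{0..t}. Y s \<omega>)) (\<lambda>_. (a + \<mu>) / b) at_top"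
  proof (rule time_average_tendsto[OF jm int nonneg])
    show "tendsto_in_prob M (\<lambda>t \<omega>. (y0 + a * t + I t \<omega> + J t \<omega>) / t) (\<lambda>_. a + \<mu>) at_top"
      by (rule affine_noise_tendsto[OF It J Im Jm])
    show "AE \<omega> in M. Y t \<omega> + b * (LBINT s:{0..t}. Y s \<omega>) = y0 + a * t + I t \<omega> + J t \<omega>" if "0 \<le> t" for t
      using eq[OF that] by (simp add: A_def)
    show "(\<lambda>\<omega>. y0 + a * t + I t \<omega> + J t \<omega>) \<in> borel_measurable M" if "0 \<le> t" for t
      using Im[OF that] Jm[OF that] by simp
  qed (use assms \<mu>0 in simp_all)
  then show ?thesis
    using \<mu>0 assms(2,3) by (simp add: \<mu>_def)
qed

end
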